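(* For every $\tau\in\mathbb{H}^2$ set $$f(\tau)=\frac{\theta^{5}\left[\begin{array}{c}1\\ \frac15\end{array}\right](0,\tau)}{\theta^{5}\left[\begin{array}{c}1\\ \frac35\end{array}\right](0,\tau)}=\frac{11+5\sqrt5}{2}\prod_{n=1}^{\infty}\frac{\left(1+\frac{1+\sqrt5}{2}q^n+q^{2n}\right)^5}{\left(1+\frac{1-\sqrt5}{2}q^n+q^{2n}\right)^5},\qquad q=\exp(2\pi i\tau).$$ Then $$\{f,\tau\}+\frac{f^4-12f^3+134f^2+12f+1}{2f^2\left(f^2-11f-1\right)^2}\,(f')^2=0 .$$
   Context: $\mathbb{H}^2=\{\tau\in\mathbb{C}\mid \Im\tau>0\}$. The prime denotes $d/d\tau$, and the Schwarzian derivative of $y=y(x)$ is $\{y,x\}=\frac{y'''}{y'}-\frac32\left(\frac{y''}{y'}\right)^2$, derivatives being taken with respect to $x$. The theta function with characteristics (Farkas–Kra convention) is $$\theta\left[\begin{array}{c}\epsilon\\ \epsilon'\end{array}\right](\zeta,\tau)=\sum_{n\in\mathbb{Z}}\exp\left(2\pi i\left[\tfrac12\left(n+\tfrac{\epsilon}{2}\right)^2\tau+\left(n+\tfrac{\epsilon}{2}\right)\left(\zeta+\tfrac{\epsilon'}{2}\right)\right]\right),$$ and $\theta^5$ denotes its fifth power. *)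

theory Defs
  imports "HOL-Complex_Analysis.Complex_Analysis"
begin

definition upper_half_plane :: "complex set" where
  "upper_half_plane = {\<tau>. Im \<tau> > 0}"

text \<open>
  Theta function with characteristics, in the convention of Farkas and Kra.
  The series converges absolutely for \<open>Im \<tau> > 0\<close>; elsewhere the value is irrelevant.
\<close>

definition theta_char :: "real \<Rightarrow> real \<Rightarrow> complex \<Rightarrow> complex \<Rightarrow> complex" where
  "theta_char \<epsilon> \<epsilon>' \<zeta> \<tau> =
     (\<Sum>\<^sub>\<infinity>n\<in>(UNIV :: int set).
        exp (2 * of_real pi * \<i> *
          (1 / 2 * (of_int n + of_real \<epsilon> / 2) ^ 2 * \<tau>
            + (of_int n + of_real \<epsilon> / 2) * (\<zeta> + of_real \<epsilon>' / 2))))"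

definition schwarzian :: "(complex \<Rightarrow> complex) \<Rightarrow> complex \<Rightarrow> complex" where
  "schwarzian y x =
     (deriv ^^ 3) y x / deriv y x - 3 / 2 * ((deriv ^^ 2) y x / deriv y x) ^ 2"

end

theory Submission
  imports Defs
begin

text \<open>
  Let \<open>theta\<close> be the odd theta function, \<open>zeta\<close> its logarithmic derivative in \<open>z\<close> and \<open>\<wp>\<close> the negative of
  the derivative of \<open>zeta\<close>. The characteristics in the theorem are shifts of the argument, so that \<open>f\<close> is the
  fifth power of \<open>theta (2/5) / theta (1/5)\<close>. The proof shows that \<open>f\<close> is a fractional linear function of
  \<open>a / b\<close>, where \<open>a = zeta (1/5)\<close> and \<open>b = zeta (2/5)\<close> are modular forms of weight one, and that \<open>a\<close> and \<open>b\<close>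
  satisfy a polynomial differential system; the Schwarzian is then a matter of algebra.

  Three facts about \<open>theta\<close> carry this. The heat equation (\<open>theta_deriv_tau\<close>) turns derivatives in \<open>\<tau>\<close> into
  derivatives in \<open>z\<close>. Weierstrass's three-term relation (\<open>theta_three_term\<close>), which follows by rearranging
  double series, factors \<open>\<wp> x - \<wp> y\<close> into theta values, and differentiating this factorisation gives addition
  and duplication formulas. The triple product (\<open>theta_product\<close>) shows that \<open>theta\<close> does not vanish where it
  occurs as a denominator, and yields the infinite product for \<open>f\<close>.

  At the points of order five the addition and duplication formulas close up (\<open>fifth_torsion_relations\<close>):
  with \<open>p = \<wp> (1/5)\<close> and \<open>D = p - \<wp> (2/5)\<close> one finds \<open>D = (a - 3 b) (3 a + b)\<close>, the values of \<open>\<wp>'\<close> are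
  \<open>- (3 a + b) D\<close> and \<open>- (a - 3 b) D\<close>, and by duplication their quotient is \<open>f\<close>. Hence
  \<open>f = (3 a + b) / (a - 3 b)\<close>, with no constant left to determine. By the heat equation \<open>a\<close>, \<open>b\<close>, \<open>p\<close> satisfy a
  closed system (\<open>fifth_torsion_system\<close>), along which \<open>4 * pi * \<i> * f' = 10 * f * A\<close> for
  \<open>A = a\<^sup>2 - 4 a b - b\<^sup>2\<close>, while \<open>f\<^sup>2 - 11 f - 1 = - 25 A / (a - 3 b)\<^sup>2\<close>. Two more derivatives give the Schwarzian
  (\<open>schwarzian_of_system\<close>).

  There remains the claim that \<open>A\<close> has no zero. It satisfies a homogeneous linear equation, so a single zero would
  make it vanish identically, and \<open>f\<close> would be a root of \<open>X\<^sup>2 - 11 X - 1\<close> everywhere. But the product shows that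
  \<open>f \<i>\<close> is real and exceeds both roots.
\<close>

section \<open>The odd theta function and the heat equation\<close>

lemma UNIV_int_halves:
  "range int \<union> range (\<lambda>n. - 1 - int n) = UNIV" "range int \<inter> range (\<lambda>n. - 1 - int n) = {}"
proof -
  have "x \<in> range int \<union> range (\<lambda>n. - 1 - int n)" for x
  proof (cases "x \<ge> 0")
    case True then show ?thesis by (metis UnI1 nat_0_le rangeI)
  next
    case False
    then have "x = - 1 - int (nat (- 1 - x))" by simp
    then show ?thesis by blast
  qed
  then show "range int \<union> range (\<lambda>n. - 1 - int n) = UNIV" by auto
qed auto

text \<open>
  Both this lemma and the next pair the index \<open>n\<close> with \<open>- 1 - n\<close>. For the theta series this is the
  reflection \<open>2 n + 1 \<mapsto> - (2 n + 1)\<close> of the frequencies, so that the pairs are sines.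
\<close>

lemma summable_on_int_halves:
  fixes g :: "int \<Rightarrow> 'a :: banach"
  assumes "(\<lambda>n. g (int n)) summable_on UNIV" "(\<lambda>n. g (- 1 - int n)) summable_on UNIV"
  shows "g summable_on UNIV"
proof -
  have 1: "g summable_on range int"
    using assms(1) by (subst summable_on_reindex) (auto simp: o_def)
  have 2: "g summable_on range (\<lambda>n. - 1 - int n)"
    using assms(2) by (subst summable_on_reindex) (auto simp: o_def inj_on_def)
  show ?thesis
    using summable_on_Un_disjoint[OF 1 2] by (simp add: UNIV_int_halves)
qed

lemma infsum_int_sums:
  fixes g :: "int \<Rightarrow> 'a :: banach"
  assumes "g summable_on UNIV"
  shows "(\<lambda>n. g (int n) + g (- 1 - int n)) sums infsum g UNIV"
proof -
  have 1: "(g has_sum infsum g (range int)) (range int)"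
    by (rule has_sum_infsum, rule summable_on_subset_banach[OF assms]) simp
  have 2: "(g has_sum infsum g (range (\<lambda>n. - 1 - int n))) (range (\<lambda>n. - 1 - int n))"
    by (rule has_sum_infsum, rule summable_on_subset_banach[OF assms]) simp
  have s: "(g has_sum infsum g (range int) + infsum g (range (\<lambda>n. - 1 - int n))) UNIV"
    using has_sum_Un_disjoint[OF 1 2 UNIV_int_halves(2)] by (simp only: UNIV_int_halves)
  have i: "inj int" "inj (\<lambda>n. - 1 - int n)" by (auto simp: inj_on_def)
  have "(\<lambda>n. g (int n)) sums infsum g (range int)"
    by (rule has_sum_imp_sums) (use 1 in \<open>simp only: has_sum_reindex[OF i(1)] o_def\<close>)
  moreover have "(\<lambda>n. g (- 1 - int n)) sums infsum g (range (\<lambda>n. - 1 - int n))"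
    by (rule has_sum_imp_sums) (use 2 in \<open>simp only: has_sum_reindex[OF i(2)] o_def\<close>)
  ultimately show ?thesis unfolding infsumI[OF s] by (rule sums_add)
qed

lemma summable_on_exp_minus_abs: "(\<lambda>n::int. exp (- \<bar>real_of_int n\<bar>)) summable_on UNIV"
proof (rule summable_on_int_halves)
  have s: "summable (\<lambda>n. exp (-1) ^ n :: real)"
    by (rule summable_geometric) simp
  have e: "exp (- real n) = exp (-1) ^ n" for n
    by (metis exp_of_nat_mult mult.commute mult_minus1)
  show "(\<lambda>n. exp (- \<bar>real_of_int (int n)\<bar>)) summable_on UNIV"
    by (rule norm_summable_imp_summable_on) (use s in \<open>simp add: e\<close>)
  have "exp (- \<bar>real_of_int (- 1 - int n)\<bar>) = exp (-1) * exp (-1) ^ n" for n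
    by (simp add: exp_add[symmetric] e[symmetric])
  then show "(\<lambda>n. exp (- \<bar>real_of_int (- 1 - int n)\<bar>)) summable_on UNIV"
    by (intro norm_summable_imp_summable_on) (use s in \<open>simp add: summable_mult\<close>)
qed

text \<open>
  The power is absorbed by an exponential through \<open>t ^ k / k! \<le> exp t\<close>, and the remaining quadratic in the
  exponent is bounded at its vertex. A bound by \<open>exp (- y)\<close> suffices for summability over the integers.
\<close>

lemma gaussian_majorant:
  fixes a b :: real
  assumes a: "a > 0"
  obtains C where "\<And>y. y \<ge> 0 \<Longrightarrow> (pi * y) ^ k * exp (b * y - a * y\<^sup>2) \<le> C * exp (- y)"
proof -
  define c where "c = b + pi + 1"
  have "(pi * y) ^ k * exp (b * y - a * y\<^sup>2) \<le> (fact k * exp (c\<^sup>2 / (4 * a))) * exp (- y)" if "y \<ge> 0" for y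
  proof -
    \<comment> \<open>A single term of the exponential series.\<close>
    have "(pi * y) ^ k / fact k \<le> exp (pi * y)"
    proof -
      have "(pi * y) ^ k / fact k = (\<Sum>n\<in>{k}. inverse (fact n) *\<^sub>R (pi * y) ^ n)" by (simp add: field_simps)
      also have "\<dots> \<le> (\<Sum>n. inverse (fact n) *\<^sub>R (pi * y) ^ n)"
        by (rule sum_le_suminf[OF summable_exp_generic]) (use that in auto)
      finally show ?thesis by (simp add: exp_def)
    qed
    then have "(pi * y) ^ k \<le> fact k * exp (pi * y)" by (simp add: field_simps)
    then have "(pi * y) ^ k * exp (b * y - a * y\<^sup>2) \<le> fact k * exp (pi * y) * exp (b * y - a * y\<^sup>2)"
      by (intro mult_right_mono) auto
    also have "\<dots> = fact k * exp (c * y - a * y\<^sup>2) * exp (- y)"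
      by (simp add: c_def exp_add[symmetric] algebra_simps)
    also have "c * y - a * y\<^sup>2 \<le> c\<^sup>2 / (4 * a)"
    proof -
      have "0 \<le> (2 * a * y - c)\<^sup>2" by simp
      then have "4 * a * (c * y - a * y\<^sup>2) \<le> c\<^sup>2" by (simp add: power2_eq_square algebra_simps)
      then show ?thesis using a by (simp add: field_simps)
    qed
    finally show ?thesis by simp
  qed
  then show ?thesis using that by blast
qed

text \<open>
  An enumeration of the integers reduces this to the theorem on uniformly convergent series of holomorphic
  functions, so that a majorant is needed for the terms only, not for their derivatives.
\<close>

lemma has_field_derivative_infsum_int:
  fixes f f' :: "int \<Rightarrow> complex \<Rightarrow> complex"
  assumes S: "open S" and M: "M summable_on UNIV"
    and d: "\<And>n x. x \<in> S \<Longrightarrow> (f n has_field_derivative f' n x) (at x)"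
    and b: "\<And>n x. x \<in> S \<Longrightarrow> norm (f n x) \<le> M n"
    and s: "\<And>x. x \<in> S \<Longrightarrow> (\<lambda>n. f' n x) summable_on UNIV"
    and x: "x \<in> S"
  shows "((\<lambda>x. \<Sum>\<^sub>\<infinity>n. f n x) has_field_derivative (\<Sum>\<^sub>\<infinity>n. f' n x)) (at x)"
proof -
  have re: "h summable_on UNIV \<Longrightarrow> (\<lambda>n. h (int_decode n)) sums infsum h UNIV" 
    for h :: "int \<Rightarrow> 'a :: banach"
    by (rule has_sum_imp_sums) (simp add: has_sum_reindex_bij_betw[OF bij_int_decode])
  have sf: "(\<lambda>n. f n x) summable_on UNIV" if "x \<in> S" for x
    using summable_on_comparison_test[OF M, of "\<lambda>n. norm (f n x)"] b[OF that] abs_summable_summable by auto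
  obtain g g' where g: "\<forall>x\<in>S. (\<lambda>n. f (int_decode n) x) sums g x \<and> (\<lambda>n. f' (int_decode n) x) sums g' x 
       \<and> (g has_field_derivative g' x) (at x)"
    by (rule series_and_derivative_comparison[OF S, of "\<lambda>n. M (int_decode n)" 
             "\<lambda>n x. f (int_decode n) x" "\<lambda>n x. f' (int_decode n) x"])
       (use re[OF M] b d in \<open>auto simp: sums_iff\<close>)
  have 1: "g y = (\<Sum>\<^sub>\<infinity>n. f n y)" if "y \<in> S" for y
    using g that re[OF sf] sums_unique2 by blast
  have 2: "g' x = (\<Sum>\<^sub>\<infinity>n. f' n x)"
    using g x re[OF s] sums_unique2 by blast
  have "(g has_field_derivative (\<Sum>\<^sub>\<infinity>n. f' n x)) (at x)" using g x 2 by auto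
  then show ?thesis
    by (rule has_field_derivative_transform_within_open[OF _ S x]) (use 1 in auto)
qed

text \<open>
  The odd theta function with its constant factor \<open>\<i>\<close> removed, that is \<open>theta_char 1 1 z \<tau> = \<i> * theta \<tau> z\<close>.
  Its frequencies are the odd multiples of \<open>pi * \<i>\<close>, and inserting their powers into the series gives all
  derivatives in \<open>z\<close> at once. As the \<open>\<tau>\<close>-exponent of a term is quadratic in its frequency, a derivative in
  \<open>\<tau>\<close> is, up to a constant factor, a second derivative in \<open>z\<close>: this is the heat equation, and it turns
  every derivative in \<open>\<tau>\<close> below into an identity between derivatives in \<open>z\<close>.
\<close>

definition theta_term :: "complex \<Rightarrow> complex \<Rightarrow> int \<Rightarrow> complex" where
  "theta_term \<tau> z n = (if even n then 1 else - 1) *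
     exp (of_real pi * \<i> * ((of_int (2 * n + 1))\<^sup>2 / 4 * \<tau> + of_int (2 * n + 1) * z))"

definition theta_deriv :: "nat \<Rightarrow> complex \<Rightarrow> complex \<Rightarrow> complex" where
  "theta_deriv k \<tau> z = (\<Sum>\<^sub>\<infinity>n. (of_int (2 * n + 1) * of_real pi * \<i>) ^ k * theta_term \<tau> z n)"

abbreviation theta :: "complex \<Rightarrow> complex \<Rightarrow> complex" where "theta \<equiv> theta_deriv 0"

lemma theta_term_majorant:
  assumes "t > 0"
  obtains M where "M summable_on UNIV"
    "\<And>n \<tau> z. t \<le> Im \<tau> \<Longrightarrow> \<bar>Im z\<bar> \<le> r \<Longrightarrow> 
       norm ((of_int (2 * n + 1) * of_real pi * \<i>) ^ k * theta_term \<tau> z n) \<le> M n"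
proof -
  obtain C where C: "\<And>y. y \<ge> 0 \<Longrightarrow> (pi * y) ^ k * exp (pi * r * y - (pi * t / 4) * y\<^sup>2) \<le> C * exp (- y)"
    using gaussian_majorant[of "pi * t / 4" k "pi * r"] assms by auto
  have C0: "C \<ge> 0"
    using C[of 0] by (cases k) auto
  show ?thesis
  proof (rule that[of "\<lambda>n. C * exp (- \<bar>real_of_int n\<bar>)"])
    show "(\<lambda>n. C * exp (- \<bar>real_of_int n\<bar>)) summable_on UNIV"
      by (intro summable_on_cmult_right summable_on_exp_minus_abs)
  next
    fix n :: int and \<tau> z :: complex
    assume t: "t \<le> Im \<tau>" and r: "\<bar>Im z\<bar> \<le> r"
    define y where "y = real_of_int (2 * n + 1)"
    have eq: "norm (theta_term \<tau> z n) = exp (- (pi * (y\<^sup>2 / 4 * Im \<tau> + y * Im z)))"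
    proof -
      have "theta_term \<tau> z n = (if even n then 1 else - 1) *
              exp (of_real pi * \<i> * (of_real (y\<^sup>2 / 4) * \<tau> + of_real y * z))"
        by (simp add: theta_term_def y_def)
      then show ?thesis by (simp add: norm_mult algebra_simps)
    qed
    have "- (y * Im z) \<le> r * \<bar>y\<bar>"
    proof -
      have "- (y * Im z) \<le> \<bar>y\<bar> * \<bar>Im z\<bar>" by (metis abs_ge_minus_self abs_mult)
      also have "\<dots> \<le> \<bar>y\<bar> * r" using r by (intro mult_left_mono) auto
      finally show ?thesis by (simp add: mult.commute)
    qed
    moreover have "y\<^sup>2 / 4 * t \<le> y\<^sup>2 / 4 * Im \<tau>" using t by (intro mult_left_mono) auto
    ultimately have "- (y\<^sup>2 / 4 * Im \<tau> + y * Im z) \<le> r * \<bar>y\<bar> - t / 4 * y\<^sup>2" by (simp add: algebra_simps)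
    then have "pi * (- (y\<^sup>2 / 4 * Im \<tau> + y * Im z)) \<le> pi * (r * \<bar>y\<bar> - t / 4 * y\<^sup>2)"
      by (intro mult_left_mono) auto
    then have "- (pi * (y\<^sup>2 / 4 * Im \<tau> + y * Im z)) \<le> pi * r * \<bar>y\<bar> - (pi * t / 4) * \<bar>y\<bar>\<^sup>2"
      by (simp add: algebra_simps)
    then have "norm (theta_term \<tau> z n) \<le> exp (pi * r * \<bar>y\<bar> - (pi * t / 4) * \<bar>y\<bar>\<^sup>2)"
      unfolding eq by simp
    moreover have "norm ((complex_of_int (2 * n + 1) * of_real pi * \<i>) ^ k) = (pi * \<bar>y\<bar>) ^ k"
      unfolding norm_power norm_mult norm_of_int by (simp add: y_def mult.commute)
    ultimately have "norm ((of_int (2 * n + 1) * of_real pi * \<i>) ^ k * theta_term \<tau> z n)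
        \<le> (pi * \<bar>y\<bar>) ^ k * exp (pi * r * \<bar>y\<bar> - (pi * t / 4) * \<bar>y\<bar>\<^sup>2)"
      unfolding norm_mult by (intro mult_mono) auto
    also have "\<dots> \<le> C * exp (- \<bar>y\<bar>)" by (rule C) auto
    also have "\<dots> \<le> C * exp (- \<bar>real_of_int n\<bar>)"
    proof (intro mult_left_mono C0)
      have "\<bar>n\<bar> \<le> \<bar>2 * n + 1\<bar>" by simp
      then have "\<bar>real_of_int n\<bar> \<le> \<bar>y\<bar>" unfolding y_def by (metis of_int_abs of_int_le_iff)
      then show "exp (- \<bar>y\<bar>) \<le> exp (- \<bar>real_of_int n\<bar>)" by simp
    qed
    finally show "norm ((of_int (2 * n + 1) * of_real pi * \<i>) ^ k * theta_term \<tau> z n)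
       \<le> C * exp (- \<bar>real_of_int n\<bar>)" .
  qed
qed

lemma theta_abs_summable:
  assumes "Im \<tau> > 0"
  shows "(\<lambda>n. norm ((of_int (2 * n + 1) * of_real pi * \<i>) ^ k * theta_term \<tau> z n)) summable_on UNIV"
proof -
  obtain M where M: "M summable_on UNIV" 
    "\<And>n. norm ((of_int (2 * n + 1) * of_real pi * \<i>) ^ k * theta_term \<tau> z n) \<le> M n"
    using theta_term_majorant[OF assms, of "\<bar>Im z\<bar>" k] by (metis order_refl)
  show ?thesis by (rule summable_on_comparison_test[OF M(1)]) (use M(2) in auto)
qed

lemmas theta_summable = abs_summable_summable[OF theta_abs_summable]

lemma theta_term_deriv_z:
  "((\<lambda>z. theta_term \<tau> z n) has_field_derivative (of_int (2 * n + 1) * of_real pi * \<i>) * theta_term \<tau> z n) (at z)"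
  unfolding theta_term_def by (auto intro!: derivative_eq_intros simp: algebra_simps)

lemma theta_term_deriv_tau:
  "((\<lambda>\<tau>. theta_term \<tau> z n) has_field_derivative
     (of_int (2 * n + 1) * of_real pi * \<i>)\<^sup>2 / (4 * of_real pi * \<i>) * theta_term \<tau> z n) (at \<tau>)"
  unfolding theta_term_def 
  by (rule derivative_eq_intros refl)+ (simp add: field_simps power2_eq_square)

lemma theta_deriv_z:
  assumes "Im \<tau> > 0"
  shows "(theta_deriv k \<tau> has_field_derivative theta_deriv (Suc k) \<tau> z) (at z)"
proof -
  define r where "r = \<bar>Im z\<bar> + 1"
  obtain M where M: "M summable_on UNIV" 
    "\<And>n w. \<bar>Im w\<bar> \<le> r \<Longrightarrow> norm ((of_int (2 * n + 1) * of_real pi * \<i>) ^ k * theta_term \<tau> w n) \<le> M n"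
    using theta_term_majorant[OF assms, of r k] by (metis order_refl)
  have S: "open {w. \<bar>Im w\<bar> < r}"
    by (intro open_Collect_less continuous_intros)
  show ?thesis unfolding theta_deriv_def [abs_def]
  proof (rule has_field_derivative_infsum_int[OF S M(1)])
    fix n w
    show "((\<lambda>w. (of_int (2 * n + 1) * of_real pi * \<i>) ^ k * theta_term \<tau> w n) has_field_derivative
       (of_int (2 * n + 1) * of_real pi * \<i>) ^ Suc k * theta_term \<tau> w n) (at w)"
      by (rule DERIV_cong[OF DERIV_cmult[OF theta_term_deriv_z]]) (simp only: power_Suc mult_ac)
  next
    fix w
    show "(\<lambda>n. (of_int (2 * n + 1) * of_real pi * \<i>) ^ Suc k * theta_term \<tau> w n) summable_on UNIV"
      by (rule theta_summable[OF assms])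
  qed (use M(2) in \<open>auto simp: r_def\<close>)
qed

lemma theta_deriv_tau:
  assumes "Im \<tau> > 0"
  shows "((\<lambda>\<tau>. theta_deriv k \<tau> z) has_field_derivative
            theta_deriv (k + 2) \<tau> z / (4 * of_real pi * \<i>)) (at \<tau>)"
proof -
  define t where "t = Im \<tau> / 2"
  have t: "t > 0" using assms by (simp add: t_def)
  obtain M where M: "M summable_on UNIV" 
    "\<And>n \<tau>. t \<le> Im \<tau> \<Longrightarrow> norm ((of_int (2 * n + 1) * of_real pi * \<i>) ^ k * theta_term \<tau> z n) \<le> M n"
    using theta_term_majorant[OF t, of "\<bar>Im z\<bar>" k] by (metis order_refl)
  have S: "open {w. t < Im w}"
    by (intro open_Collect_less continuous_intros)
  have "((\<lambda>\<tau>. theta_deriv k \<tau> z) has_field_derivative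
     (\<Sum>\<^sub>\<infinity>n. 1 / (4 * of_real pi * \<i>) * ((of_int (2 * n + 1) * of_real pi * \<i>) ^ (k + 2) * theta_term \<tau> z n))) (at \<tau>)"
    unfolding theta_deriv_def
  proof (rule has_field_derivative_infsum_int[OF S M(1)])
    fix n w
    show "((\<lambda>\<tau>. (of_int (2 * n + 1) * of_real pi * \<i>) ^ k * theta_term \<tau> z n) has_field_derivative
       1 / (4 * of_real pi * \<i>) * ((of_int (2 * n + 1) * of_real pi * \<i>) ^ (k + 2) * theta_term w z n)) (at w)"
      by (rule DERIV_cong[OF DERIV_cmult[OF theta_term_deriv_tau]]) 
         (simp add: field_simps power2_eq_square)
  next
    fix w assume "w \<in> {w. t < Im w}"
    then have "Im w > 0" using t by auto
    then show "(\<lambda>n. 1 / (4 * of_real pi * \<i>) *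
        ((of_int (2 * n + 1) * of_real pi * \<i>) ^ (k + 2) * theta_term w z n)) summable_on UNIV"
      by (intro summable_on_cmult_right theta_summable)
  qed (use M(2) assms in \<open>auto simp: t_def\<close>)
  also have "(\<Sum>\<^sub>\<infinity>n. 1 / (4 * of_real pi * \<i>) * ((of_int (2 * n + 1) * of_real pi * \<i>) ^ (k + 2) * theta_term \<tau> z n))
     = theta_deriv (k + 2) \<tau> z / (4 * of_real pi * \<i>)"
    unfolding theta_deriv_def by (subst infsum_cmult_right') simp
  finally show ?thesis .
qed

lemma theta_deriv_minus: "theta_deriv k \<tau> (- z) = (- 1) ^ Suc k * theta_deriv k \<tau> z"
proof -
  have bij: "bij_betw (\<lambda>n::int. - 1 - n) UNIV UNIV"
    by (rule bij_betwI[of _ _ _ "\<lambda>n. - 1 - n"]) auto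
  have t: "theta_term \<tau> (- z) (- 1 - n) = - theta_term \<tau> z n" for n
    by (simp add: theta_term_def algebra_simps power2_eq_square)
  have c: "complex_of_int (2 * (- 1 - n) + 1) * of_real pi * \<i> = (- 1) * (of_int (2 * n + 1) * of_real pi * \<i>)" for n
    by (simp add: algebra_simps)
  have "theta_deriv k \<tau> (- z) = (\<Sum>\<^sub>\<infinity>n. (of_int (2 * (- 1 - n) + 1) * of_real pi * \<i>) ^ k * theta_term \<tau> (- z) (- 1 - n))"
    unfolding theta_deriv_def by (rule infsum_reindex_bij_betw[OF bij, symmetric])
  also have "\<dots> = (\<Sum>\<^sub>\<infinity>n. (- 1) ^ Suc k * ((of_int (2 * n + 1) * of_real pi * \<i>) ^ k * theta_term \<tau> z n))"
    unfolding t c power_mult_distrib by (simp add: mult.assoc)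
  also have "\<dots> = (- 1) ^ Suc k * theta_deriv k \<tau> z"
    unfolding theta_deriv_def by (subst infsum_cmult_right') simp
  finally show ?thesis .
qed

lemma theta_deriv_add_one: "theta_deriv k \<tau> (z + 1) = - theta_deriv k \<tau> z"
proof -
  have t: "theta_term \<tau> (z + 1) n = - theta_term \<tau> z n" for n
  proof -
    have "exp (of_real pi * \<i> * of_int (2 * n + 1)) = (-1 :: complex)"
      using exp_two_pi_i exp_integer_2pi[of "of_int n"]
      by (simp add: exp_add algebra_simps)
    moreover have "theta_term \<tau> (z + 1) n = theta_term \<tau> z n * exp (of_real pi * \<i> * of_int (2 * n + 1))"
      unfolding theta_term_def mult.assoc exp_add[symmetric] by (simp add: algebra_simps)
    ultimately show ?thesis by simp
  qed
  show ?thesis unfolding theta_deriv_def t by (simp add: infsum_uminus)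
qed

section \<open>The three-term relation\<close>

lemma infsum_mult_Times:
  fixes f :: "'a \<Rightarrow> complex" and g :: "'b \<Rightarrow> complex"
  assumes f: "(\<lambda>i. norm (f i)) summable_on A" and g: "(\<lambda>j. norm (g j)) summable_on B"
  shows "(\<lambda>(i, j). f i * g j) summable_on A \<times> B"
    and "infsum f A * infsum g B = (\<Sum>\<^sub>\<infinity>(i, j)\<in>A \<times> B. f i * g j)"
proof -
  have "(\<lambda>ij. norm (case ij of (i, j) \<Rightarrow> f i * g j)) summable_on A \<times> B"
    unfolding Infinite_Sum.abs_summable_on_Sigma_iff
    by (auto simp: norm_mult abs_mult infsum_cmult_right' intro!: summable_on_cmult_right g summable_on_cmult_left f)
  then show s: "(\<lambda>(i, j). f i * g j) summable_on A \<times> B"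
    by (rule abs_summable_summable)
  have "(\<Sum>\<^sub>\<infinity>(i, j)\<in>A \<times> B. f i * g j) = (\<Sum>\<^sub>\<infinity>i\<in>A. \<Sum>\<^sub>\<infinity>j\<in>B. f i * g j)"
    by (rule infsum_Sigma'_banach[symmetric]) (use s in simp)
  also have "\<dots> = infsum f A * infsum g B"
    by (simp add: infsum_cmult_right' infsum_cmult_left')
  finally show "infsum f A * infsum g B = (\<Sum>\<^sub>\<infinity>(i, j)\<in>A \<times> B. f i * g j)" by simp
qed

text \<open>
  Terms of the theta functions of the doubled period \<open>2 * \<tau>\<close> at \<open>2 * x\<close>, in which a product of two theta
  values splits after a rotation of the index lattice by 45 degrees.
\<close>

definition gauss_term :: "complex \<Rightarrow> complex \<Rightarrow> int \<Rightarrow> complex" where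
  "gauss_term \<tau> x r = exp (of_real pi * \<i> * ((of_int r)\<^sup>2 / 2 * \<tau> + 2 * of_int r * x))"

lemma gauss_term_abs_summable:
  assumes "Im \<tau> > 0"
  shows "(\<lambda>r. norm (gauss_term \<tau> x r)) summable_on A"
proof -
  obtain C where C: "\<And>y. y \<ge> 0 \<Longrightarrow> (pi * y) ^ 0 * exp (2 * pi * \<bar>Im x\<bar> * y - (pi * Im \<tau> / 2) * y\<^sup>2) \<le> C * exp (- y)"
    using gaussian_majorant[of "pi * Im \<tau> / 2" 0 "2 * pi * \<bar>Im x\<bar>"] assms by auto
  have "norm (gauss_term \<tau> x r) \<le> C * exp (- \<bar>real_of_int r\<bar>)" for r
  proof -
    define y where "y = real_of_int r"
    have "gauss_term \<tau> x r = exp (of_real pi * \<i> * (of_real (y\<^sup>2 / 2) * \<tau> + of_real (2 * y) * x))"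
      by (simp add: gauss_term_def y_def)
    then have "norm (gauss_term \<tau> x r) = exp (- (pi * (y\<^sup>2 / 2 * Im \<tau> + 2 * y * Im x)))"
      by (simp add: algebra_simps)
    also have "\<dots> \<le> exp (2 * pi * \<bar>Im x\<bar> * \<bar>y\<bar> - (pi * Im \<tau> / 2) * \<bar>y\<bar>\<^sup>2)"
    proof -
      have "- (y * Im x) \<le> \<bar>Im x\<bar> * \<bar>y\<bar>" by (metis abs_ge_minus_self abs_mult mult.commute)
      then have "pi * - (y * Im x) \<le> pi * (\<bar>Im x\<bar> * \<bar>y\<bar>)" by (intro mult_left_mono) auto
      then show ?thesis by (simp add: algebra_simps)
    qed
    also have "\<dots> \<le> C * exp (- \<bar>y\<bar>)" using C[of "\<bar>y\<bar>"] by simp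
    finally show ?thesis by (simp add: y_def)
  qed
  then have "(\<lambda>r. norm (gauss_term \<tau> x r)) summable_on UNIV"
    by (intro summable_on_comparison_test[OF summable_on_cmult_right[OF summable_on_exp_minus_abs]]) auto
  then show ?thesis using summable_on_subset_banach by blast
qed

definition gauss_sum :: "complex \<Rightarrow> int set \<Rightarrow> complex \<Rightarrow> complex" where
  "gauss_sum \<tau> A x = (\<Sum>\<^sub>\<infinity>r\<in>A. gauss_term \<tau> x r)"

lemma gauss_sum_mult:
  assumes "Im \<tau> > 0"
  shows "((\<lambda>(r, s). gauss_term \<tau> x r * gauss_term \<tau> y s) has_sum gauss_sum \<tau> A x * gauss_sum \<tau> B y) (A \<times> B)"
  using infsum_mult_Times[where A = A and B = B and f = "gauss_term \<tau> x" and g = "gauss_term \<tau> y",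
      OF gauss_term_abs_summable[OF assms] gauss_term_abs_summable[OF assms]]
  unfolding gauss_sum_def by (simp add: summable_iff_has_sum_infsum)

text \<open>
  With \<open>r = m + n + 1\<close> and \<open>s = m - n\<close> the exponent of the term with indices \<open>(m, n)\<close> separates into a part in
  \<open>x\<close> and \<open>r\<close> and a part in \<open>y\<close> and \<open>s\<close>. The pairs \<open>(r, s)\<close> that occur are exactly those of opposite parity,
  which gives two products, and the sign of the term depends only on the parity of \<open>r\<close>.
\<close>

lemma theta_mult_theta:
  assumes "Im \<tau> > 0"
  shows "theta \<tau> (x + y) * theta \<tau> (x - y) =
     gauss_sum \<tau> {r. odd r} x * gauss_sum \<tau> {r. even r} y - gauss_sum \<tau> {r. even r} x * gauss_sum \<tau> {r. odd r} y"
proof -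
  let ?E = "{r::int. even r}" and ?O = "{r::int. odd r}"
  define g where "g = (\<lambda>(r, s). (if odd r then 1 else - 1) * (gauss_term \<tau> x r * gauss_term \<tau> y s))"
  have bij: "bij_betw (\<lambda>(m, n). (m + n + 1, m - n)) (UNIV \<times> UNIV) (?O \<times> ?E \<union> ?E \<times> ?O)"
  proof (rule bij_betwI[where g = "\<lambda>(r, s). ((r + s - 1) div 2, (r - s - 1) div 2)"])
    show "(\<lambda>(m, n). (m + n + 1, m - n)) \<in> UNIV \<times> UNIV \<rightarrow> ?O \<times> ?E \<union> ?E \<times> ?O" by auto
    show "(case case p of (m, n) \<Rightarrow> (m + n + 1, m - n) of (r, s) \<Rightarrow> ((r + s - 1) div 2, (r - s - 1) div 2)) = p"
      for p :: "int \<times> int" by (cases p) simp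
    show "(case case p of (r, s) \<Rightarrow> ((r + s - 1) div 2, (r - s - 1) div 2) of (m, n) \<Rightarrow> (m + n + 1, m - n)) = p"
      if "p \<in> ?O \<times> ?E \<union> ?E \<times> ?O" for p :: "int \<times> int"
      using that by (cases p) (auto elim!: evenE oddE)
  qed auto
  have tt: "theta_term \<tau> (x + y) m * theta_term \<tau> (x - y) n = g (m + n + 1, m - n)" for m n
  proof -
    have "theta_term \<tau> (x + y) m * theta_term \<tau> (x - y) n =
       (if even (m + n) then 1 else - 1) *
        exp (of_real pi * \<i> * ((of_int (2 * m + 1))\<^sup>2 / 4 * \<tau> + of_int (2 * m + 1) * (x + y))
           + of_real pi * \<i> * ((of_int (2 * n + 1))\<^sup>2 / 4 * \<tau> + of_int (2 * n + 1) * (x - y)))"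
      unfolding theta_term_def exp_add by auto
    also have "of_real pi * \<i> * ((of_int (2 * m + 1))\<^sup>2 / 4 * \<tau> + of_int (2 * m + 1) * (x + y))
           + of_real pi * \<i> * ((of_int (2 * n + 1))\<^sup>2 / 4 * \<tau> + of_int (2 * n + 1) * (x - y)) =
         of_real pi * \<i> * ((of_int (m + n + 1))\<^sup>2 / 2 * \<tau> + 2 * of_int (m + n + 1) * x)
           + of_real pi * \<i> * ((of_int (m - n))\<^sup>2 / 2 * \<tau> + 2 * of_int (m - n) * y)"
      by (simp add: field_simps power2_eq_square)
    finally show ?thesis unfolding g_def gauss_term_def exp_add by auto
  qed
  have s: "(\<lambda>n. norm (theta_term \<tau> z n)) summable_on UNIV" for z
    using theta_abs_summable[OF assms, of 0 z] by simp
  have "theta \<tau> (x + y) * theta \<tau> (x - y) = 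
      (\<Sum>\<^sub>\<infinity>(m, n)\<in>UNIV \<times> UNIV. theta_term \<tau> (x + y) m * theta_term \<tau> (x - y) n)"
    unfolding theta_deriv_def by (simp add: infsum_mult_Times(2)[OF s s])
  also have "\<dots> = (\<Sum>\<^sub>\<infinity>p\<in>UNIV \<times> UNIV. g ((\<lambda>(m, n). (m + n + 1, m - n)) p))"
    by (intro infsum_cong) (auto simp: tt)
  also have "\<dots> = infsum g (?O \<times> ?E \<union> ?E \<times> ?O)"
    by (rule infsum_reindex_bij_betw[OF bij])
  also have "(g has_sum gauss_sum \<tau> ?O x * gauss_sum \<tau> ?E y + - (gauss_sum \<tau> ?E x * gauss_sum \<tau> ?O y))
      (?O \<times> ?E \<union> ?E \<times> ?O)"
  proof (rule has_sum_Un_disjoint)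
    show "(g has_sum gauss_sum \<tau> ?O x * gauss_sum \<tau> ?E y) (?O \<times> ?E)"
      using gauss_sum_mult[OF assms, of x y ?O ?E]
      by (rule iffD1[OF has_sum_cong, rotated]) (auto simp: g_def)
    show "(g has_sum - (gauss_sum \<tau> ?E x * gauss_sum \<tau> ?O y)) (?E \<times> ?O)"
      using gauss_sum_mult[OF assms, of x y ?E ?O, THEN has_sum_uminusI]
      by (rule iffD1[OF has_sum_cong, rotated]) (auto simp: g_def)
  qed auto
  then have "infsum g (?O \<times> ?E \<union> ?E \<times> ?O) = gauss_sum \<tau> ?O x * gauss_sum \<tau> ?E y + - (gauss_sum \<tau> ?E x * gauss_sum \<tau> ?O y)"
    by (rule infsumI)
  finally show ?thesis by simp
qed

text \<open>
  Weierstrass's relation in the case where one of the four arguments vanishes. The map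
  \<open>(x, y) \<mapsto> theta \<tau> (x + y) * theta \<tau> (x - y)\<close> is an alternating form of rank two by the preceding lemma,
  and the three terms are the Pluecker relation for such a form.
\<close>

lemma theta_three_term:
  assumes "Im \<tau> > 0"
  shows "(theta \<tau> v)\<^sup>2 * (theta \<tau> (x + y) * theta \<tau> (x - y))
       + (theta \<tau> x)\<^sup>2 * (theta \<tau> (y + v) * theta \<tau> (y - v))
       + (theta \<tau> y)\<^sup>2 * (theta \<tau> (v + x) * theta \<tau> (v - x)) = 0"
proof -
  have sq: "(theta \<tau> z)\<^sup>2 = theta \<tau> (z + 0) * theta \<tau> (z - 0)" for z
    by (simp add: power2_eq_square)
  show ?thesis
    unfolding sq theta_mult_theta[OF assms] by (simp add: algebra_simps)
qed

section \<open>The triple product\<close>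

definition qfact :: "complex \<Rightarrow> nat \<Rightarrow> complex" where
  "qfact q n = (\<Prod>k<n. 1 - q ^ Suc k)"

text \<open>
  The value \<open>0\<close> at negative arguments is the convention under which \<open>inv_qfact_pred\<close> holds for all integers.
  It spares the recurrence of the coefficients below any separate treatment of the boundary.
\<close>

definition inv_qfact :: "complex \<Rightarrow> int \<Rightarrow> complex" where
  "inv_qfact q k = (if k < 0 then 0 else 1 / qfact q (nat k))"

text \<open>
  Up to sign and power of \<open>q\<close> this is the Gaussian binomial coefficient of \<open>2 * m + 1\<close> over \<open>m - n\<close>.
\<close>

definition triple_coeff :: "complex \<Rightarrow> nat \<Rightarrow> int \<Rightarrow> complex" where
  "triple_coeff q m n = (if even n then 1 else - 1) * q ^ nat (n * (n + 1) div 2) *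
     (qfact q (2 * m + 1) * inv_qfact q (int m - n) * inv_qfact q (int m + n + 1))"

lemma power_neq_one:
  fixes q :: complex
  assumes "norm q < 1" shows "q ^ Suc n \<noteq> 1"
proof
  assume "q ^ Suc n = 1"
  then have "norm q ^ Suc n = 1" by (metis norm_one norm_power)
  moreover have "norm q ^ Suc n < 1" using assms by (simp add: power_less_one_iff del: power_Suc)
  ultimately show False by simp
qed

lemma qfact_nonzero: "norm q < 1 \<Longrightarrow> qfact q n \<noteq> 0"
  using power_neq_one[of q] unfolding qfact_def by (simp del: power_Suc)

lemma inv_qfact_pred:
  assumes "norm q < 1"
  shows "inv_qfact q (k - 1) = (1 - q ^ nat k) * inv_qfact q k"
proof (cases "k \<le> 0")
  case True then show ?thesis by (auto simp: inv_qfact_def)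
next
  case False
  then obtain j where j: "k = int (Suc j)" by (metis not_le zero_less_imp_eq_int gr0_implies_Suc)
  have "qfact q (Suc j) = qfact q j * (1 - q ^ Suc j)" by (simp add: qfact_def)
  moreover have "1 - q ^ Suc j \<noteq> 0" using power_neq_one[OF assms, of j] by simp
  ultimately show ?thesis using qfact_nonzero[OF assms, of j] 
    unfolding j inv_qfact_def by (simp del: power_Suc add: nat_add_distrib)
qed

text \<open>
  This is how the coefficients change when the product gains the factor \<open>1 - w * c + c\<^sup>2\<close> with
  \<open>c = q ^ (m + 1)\<close>, because \<open>w\<close> acts on the sequence as the sum of the two shifts of the index. Every coefficient is a multiple of the same two inverse \<open>q\<close>-factorials \<open>Y\<close> and \<open>Z\<close>, and in terms of
  \<open>u = q ^ (m + 1 - n)\<close> and \<open>v = q ^ (m + n + 1)\<close> the claim is a polynomial identity.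
\<close>

lemma triple_coeff_Suc:
  assumes q: "norm q < 1" and n: "n \<ge> 0"
  shows "triple_coeff q (Suc m) n = (1 + q ^ (2 * m + 2)) * triple_coeff q m n
     - q ^ Suc m * (triple_coeff q m (n - 1) + triple_coeff q m (n + 1))"
proof (cases "n > int m + 1")
  case True then show ?thesis by (simp add: triple_coeff_def inv_qfact_def)
next
  case False
  define u where "u = q ^ nat (int m + 1 - n)"
  \<comment> \<open>For \<open>n = m + 1\<close> the exponent is truncated to \<open>0\<close>; there \<open>1 - u = 0\<close>, and so \<open>uu\<close> below still holds.\<close>
  define u' where "u' = q ^ nat (int m - n)"
  define v where "v = q ^ nat (int m + n + 1)"
  define t where "t = q ^ nat ((n - 1) * n div 2)"
  define s :: complex where "s = (if even n then 1 else - 1)"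
  define X where "X = qfact q (2 * m + 1)"
  define Y where "Y = inv_qfact q (int m + 1 - n)"
  define Z where "Z = inv_qfact q (int m + n + 2)"
  have u: "u * v = q ^ (2 * m + 2)" "q ^ Suc m = u * q ^ nat n" "q * v = q ^ nat (int m + n + 2)"
    using False n unfolding u_def v_def by (auto simp: power_add[symmetric] power_Suc[symmetric]
        nat_add_distrib[symmetric] simp del: power_Suc intro!: arg_cong[of _ _ "(^) q"])
  have t1: "q ^ nat (n * (n + 1) div 2) = t * q ^ nat n"
  proof -
    have "n * (n + 1) = (n - 1) * n + n * 2" by (simp add: algebra_simps)
    then have "n * (n + 1) div 2 = (n - 1) * n div 2 + n" by simp
    moreover have "(n - 1) * n div 2 \<ge> 0" using n by (cases "n = 0") auto
    ultimately show ?thesis using n by (simp add: t_def power_add nat_add_distrib)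
  qed
  have t2: "q ^ nat ((n + 1) * (n + 1 + 1) div 2) = t * q ^ nat n * (q * q ^ nat n)"
  proof -
    have "(n + 1) * (n + 1 + 1) = n * (n + 1) + (n + 1) * 2" by (simp add: algebra_simps)
    then have "(n + 1) * (n + 1 + 1) div 2 = n * (n + 1) div 2 + (n + 1)" by simp
    moreover have "n * (n + 1) div 2 \<ge> 0" using n by auto
    ultimately have "nat ((n + 1) * (n + 1 + 1) div 2) = nat (n * (n + 1) div 2) + Suc (nat n)"
      using n by (simp only: nat_add_distrib) (simp add: nat_add_distrib)
    then show ?thesis by (simp only: t1 power_add power_Suc)
  qed
  have R1: "inv_qfact q (int m - n) = (1 - u) * Y"
    using inv_qfact_pred[OF q, of "int m + 1 - n"] by (simp add: u_def Y_def)
  have R2: "inv_qfact q (int m - (n + 1)) = (1 - u') * ((1 - u) * Y)"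
    using inv_qfact_pred[OF q, of "int m - n"] by (simp add: u'_def R1 algebra_simps)
  have R3: "inv_qfact q (int m + n + 1) = (1 - q * v) * Z"
    using inv_qfact_pred[OF q, of "int m + n + 2"] by (simp add: u Z_def algebra_simps)
  have R4: "inv_qfact q (int m + (n - 1) + 1) = (1 - v) * ((1 - q * v) * Z)"
    using inv_qfact_pred[OF q, of "int m + n + 1"] unfolding R3 v_def[symmetric] by simp
  have R5: "inv_qfact q (int m - (n - 1)) = Y" "inv_qfact q (int (Suc m) - n) = Y"
    "inv_qfact q (int m + (n + 1) + 1) = Z" "inv_qfact q (int (Suc m) + n + 1) = Z" 
    by (simp_all add: Y_def Z_def algebra_simps)
  have X: "qfact q (2 * Suc m + 1) = X * (1 - u * v) * (1 - q * (u * v))"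
    unfolding u X_def by (simp add: qfact_def)
  have uu: "q * ((1 - u) * (1 - u')) = (1 - u) * (q - u)"
  proof (cases "n = int m + 1")
    case True then show ?thesis by (simp add: u_def)
  next
    case ne: False
    then have "nat (int m + 1 - n) = Suc (nat (int m - n))" using False by simp
    then have "u = q * u'" by (simp add: u_def u'_def)
    then show ?thesis by (simp add: algebra_simps)
  qed
  have sg: "(if even (n - 1) then 1 else - 1) = - s" "(if even (n + 1) then 1 else - 1) = - s"
    by (auto simp: s_def)
  have c0: "triple_coeff q (Suc m) n = s * (t * q ^ nat n) * (X * (1 - u * v) * (1 - q * (u * v)) * Y * Z)"
    unfolding triple_coeff_def R5 X t1 s_def[symmetric] ..
  have c1: "triple_coeff q m n = s * (t * q ^ nat n) * (X * ((1 - u) * Y) * ((1 - q * v) * Z))"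
    unfolding triple_coeff_def R1 R3 X_def[symmetric] t1 s_def[symmetric] ..
  have c2: "triple_coeff q m (n - 1) = - s * t * (X * Y * ((1 - v) * ((1 - q * v) * Z)))"
    unfolding triple_coeff_def R5 R4 X_def[symmetric] sg by (simp add: t_def)
  have c3: "triple_coeff q m (n + 1) = - s * (t * q ^ nat n * (q * q ^ nat n)) * (X * ((1 - u') * ((1 - u) * Y)) * Z)"
    unfolding triple_coeff_def R5 R2 X_def[symmetric] sg t2 ..
  have v': "v = q ^ nat n * q ^ nat n * u"
  proof -
    have "nat (int m + n + 1) = nat n + nat n + nat (int m + 1 - n)" using False n by linarith
    then show ?thesis by (simp add: u_def v_def power_add)
  qed
  have "(1 - u * v) * (1 - q * (u * v)) = (1 + u * v) * (1 - u) * (1 - q * v) + u * (1 - q * v) * (1 - v)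
     + v * (q * ((1 - u) * (1 - u')))"
    unfolding uu by (simp add: algebra_simps)
  then have "s * (t * q ^ nat n) * X * Y * Z * ((1 - u * v) * (1 - q * (u * v))) = 
     s * (t * q ^ nat n) * X * Y * Z * ((1 + u * v) * (1 - u) * (1 - q * v) + u * (1 - q * v) * (1 - v)
     + q ^ nat n * q ^ nat n * u * (q * ((1 - u) * (1 - u'))))"
    using v' by simp
  then show ?thesis unfolding c0 c1 c2 c3 u(1)[symmetric] u(2) by (simp add: algebra_simps)
qed

text \<open>
  This antisymmetry is the boundary condition at \<open>n = 0\<close>; it corresponds to the relation
  \<open>s 1 = (w + 1) * s 0\<close> in the next lemma, which continues \<open>s\<close> by \<open>s (- 1) = - s 0\<close>.
\<close>

lemma triple_coeff_minus_one: "triple_coeff q m (- 1) = - triple_coeff q m 0"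
  by (simp add: triple_coeff_def algebra_simps)

text \<open>
  The finite form of Jacobi's triple product, for any solution \<open>s\<close> of the three-term recurrence with parameter
  \<open>w\<close> that is odd under \<open>n \<mapsto> - 1 - n\<close>. The solution \<open>sin ((2 * n + 1) * pi * x)\<close> with \<open>w = 2 * cos (2 * pi * x)\<close> gives
  the theta function, and the degenerate solution \<open>2 * n + 1\<close> with \<open>w = 2\<close> gives its derivative at the origin.
\<close>

lemma finite_triple_product:
  fixes s :: "nat \<Rightarrow> complex"
  assumes q: "norm q < 1" and s0: "s 1 = (w + 1) * s 0" and s: "\<And>n. s (Suc (Suc n)) = w * s (Suc n) - s n"
  shows "s 0 * (\<Prod>k<m. 1 - w * q ^ Suc k + q ^ (2 * Suc k)) = (\<Sum>n\<le>m. triple_coeff q m (int n) * s n)"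
proof (induction m)
  case 0
  have "1 - q \<noteq> 0" using q by auto
  then show ?case by (simp add: triple_coeff_def inv_qfact_def qfact_def)
next
  case (Suc m)
  define c where "c = q ^ Suc m"
  define d where "d n = triple_coeff q m (int n)" for n
  have c2: "c\<^sup>2 = q ^ (2 * m + 2)" by (simp add: c_def power_mult[symmetric] power2_eq_square power_add[symmetric] mult_2)
  have d0: "d n = 0" if "n > m" for n using that by (simp add: d_def triple_coeff_def inv_qfact_def)
  have r0: "triple_coeff q (Suc m) (int 0) = (1 + c\<^sup>2) * d 0 - c * (d 1 - d 0)"
    using triple_coeff_Suc[OF q, of 0 m] unfolding c2[symmetric] c_def[symmetric]
    by (simp add: d_def triple_coeff_minus_one)
  have r: "triple_coeff q (Suc m) (int (Suc n)) = (1 + c\<^sup>2) * d (Suc n) - c * (d n + d (Suc (Suc n)))" for n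
    using triple_coeff_Suc[OF q, of "int (Suc n)" m] unfolding c2[symmetric] c_def[symmetric]
    by (simp add: d_def algebra_simps)
  have w: "w * s (Suc n) = s (Suc (Suc n)) + s n" for n using s[of n] by simp
  have e1: "(\<Sum>n\<le>m. d n * s n) = d 0 * s 0 + (\<Sum>n\<le>m. d (Suc n) * s (Suc n))"
    using sum.atMost_Suc_shift[of "\<lambda>n. d n * s n" m] d0[of "Suc m"] by simp
  have e2: "(\<Sum>n\<le>m. d n * s (Suc n)) = d 0 * s 1 + (\<Sum>n\<le>m. d (Suc n) * s (Suc (Suc n)))"
    using sum.atMost_Suc_shift[of "\<lambda>n. d n * s (Suc n)" m] d0[of "Suc m"] by simp
  have e3: "(\<Sum>n\<le>m. d (Suc n) * s n) = d 1 * s 0 + (\<Sum>n\<le>m. d (Suc (Suc n)) * s (Suc n))"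
    using sum.atMost_Suc_shift[of "\<lambda>n. d (Suc n) * s n" m] d0[of "Suc m"] d0[of "Suc (Suc m)"] by simp
  have "(\<Sum>n\<le>Suc m. triple_coeff q (Suc m) (int n) * s n) =
      ((1 + c\<^sup>2) * d 0 - c * (d 1 - d 0)) * s 0 + 
      (\<Sum>n\<le>m. ((1 + c\<^sup>2) * d (Suc n) - c * (d n + d (Suc (Suc n)))) * s (Suc n))"
    by (subst sum.atMost_Suc_shift) (simp only: r r0)
  also have "(\<Sum>n\<le>m. ((1 + c\<^sup>2) * d (Suc n) - c * (d n + d (Suc (Suc n)))) * s (Suc n)) =
      (1 + c\<^sup>2) * (\<Sum>n\<le>m. d (Suc n) * s (Suc n)) - c * ((\<Sum>n\<le>m. d n * s (Suc n)) + (\<Sum>n\<le>m. d (Suc (Suc n)) * s (Suc n)))"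
    by (simp add: sum_distrib_left sum.distrib[symmetric] sum_subtractf[symmetric] algebra_simps)
  also have "((1 + c\<^sup>2) * d 0 - c * (d 1 - d 0)) * s 0 + \<dots> = 
      (1 + c\<^sup>2) * (\<Sum>n\<le>m. d n * s n) - c * (d 0 * (s 1 - s 0) + (\<Sum>n\<le>m. d (Suc n) * (s (Suc (Suc n)) + s n)))"
    unfolding distrib_left sum.distrib e3 e1 e2 by (simp add: algebra_simps)
  also have "d 0 * (s 1 - s 0) + (\<Sum>n\<le>m. d (Suc n) * (s (Suc (Suc n)) + s n)) = w * (\<Sum>n\<le>m. d n * s n)"
    unfolding w[symmetric] e1 s0 by (simp add: sum_distrib_left algebra_simps)
  also have "(1 + c\<^sup>2) * (\<Sum>n\<le>m. d n * s n) - c * (w * (\<Sum>n\<le>m. d n * s n)) = 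
     (\<Sum>n\<le>m. d n * s n) * (1 - w * c + c\<^sup>2)" by (simp add: algebra_simps)
  also have "(\<Sum>n\<le>m. d n * s n) = s 0 * (\<Prod>k<m. 1 - w * q ^ Suc k + q ^ (2 * Suc k))"
    using Suc.IH by (simp add: d_def)
  finally have "(\<Sum>n\<le>Suc m. triple_coeff q (Suc m) (int n) * s n) =
      s 0 * (\<Prod>k<m. 1 - w * q ^ Suc k + q ^ (2 * Suc k)) * (1 - w * c + c\<^sup>2)" .
  moreover have "c\<^sup>2 = q ^ (2 * Suc m)" unfolding c2 by simp
  ultimately show ?case unfolding prod.lessThan_Suc c_def by (simp only: mult.assoc)
qed

lemma convergent_prod_one_plus_powers:
  assumes q: "norm (q::complex) < 1"
  shows "convergent_prod (\<lambda>k. 1 - w * q ^ Suc k + q ^ (2 * Suc k))"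
proof -
  have "summable (\<lambda>k. norm (- w * q) * norm q ^ k + norm (q\<^sup>2) * norm (q\<^sup>2) ^ k)"
    using q by (intro summable_add summable_mult summable_geometric) 
      (auto simp: norm_power power_less_one_iff)
  then have "summable (\<lambda>k. norm (- w * q ^ Suc k + q ^ (2 * Suc k)))"
  proof (rule summable_comparison_test'[where N = 0])
    fix n
    have "norm (- w * q ^ Suc n + q ^ (2 * Suc n)) \<le> norm (- w * q ^ Suc n) + norm (q ^ (2 * Suc n))"
      by (rule norm_triangle_ineq)
    moreover have "norm (q ^ (2 * Suc n)) = norm (q\<^sup>2) * norm (q\<^sup>2) ^ n" by (metis power_Suc power_mult norm_mult norm_power)
    moreover have "norm (- w * q ^ Suc n) = norm (- w * q) * norm q ^ n" by (simp add: norm_mult norm_power)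
    ultimately show "norm (norm (- w * q ^ Suc n + q ^ (2 * Suc n))) \<le> norm (- w * q) * norm q ^ n + norm (q\<^sup>2) * norm (q\<^sup>2) ^ n"
      by simp
  qed
  then have "abs_convergent_prod (\<lambda>k. 1 + (- w * q ^ Suc k + q ^ (2 * Suc k)))"
    by (intro summable_imp_abs_convergent_prod) (simp add: algebra_simps)
  then show ?thesis
    using abs_convergent_prod_imp_convergent_prod by (simp add: algebra_simps)
qed

lemma qfact_limit:
  assumes q: "norm q < 1"
  obtains Q where "Q \<noteq> 0" "qfact q \<longlonglongrightarrow> Q"
proof -
  have "summable (\<lambda>k. norm (1 - q ^ Suc k - 1))"
    using q by (simp add: norm_mult norm_power summable_mult)
  then have c: "convergent_prod (\<lambda>k. 1 - q ^ Suc k)"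
    by (intro abs_convergent_prod_imp_convergent_prod summable_imp_abs_convergent_prod)
  have nz: "1 - q ^ Suc k \<noteq> 0" for k using power_neq_one[OF q, of k] by simp
  show ?thesis
  proof (rule that)
    show "(\<Prod>k. 1 - q ^ Suc k) \<noteq> 0" using prodinf_nonzero[OF c] nz by blast
    have "(\<lambda>n. \<Prod>k<Suc n. 1 - q ^ Suc k) \<longlonglongrightarrow> (\<Prod>k. 1 - q ^ Suc k)"
      using convergent_prod_LIMSEQ[OF c] by (simp only: lessThan_Suc_atMost)
    then show "qfact q \<longlonglongrightarrow> (\<Prod>k. 1 - q ^ Suc k)"
      unfolding qfact_def[abs_def] by (rule LIMSEQ_imp_Suc)
  qed
qed

text \<open>
  The limit of the finite identity by dominated convergence. The constant \<open>K\<close> is the limit of the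
  \<open>q\<close>-factorials; only its independence of \<open>w\<close> and \<open>s\<close> matters, because it cancels from quotients of theta values.
\<close>

lemma triple_product:
  fixes q :: complex
  assumes q: "norm q < 1"
  obtains K where "K \<noteq> 0" 
    "\<And>w s. s 1 = (w + 1) * s 0 \<Longrightarrow> (\<And>n. s (Suc (Suc n)) = w * s (Suc n) - s n) \<Longrightarrow>
       summable (\<lambda>n. norm (q ^ (n * (n + 1) div 2) * s n)) \<Longrightarrow>
       (\<Sum>n. (- 1) ^ n * q ^ (n * (n + 1) div 2) * s n) = K * s 0 * (\<Prod>k. 1 - w * q ^ Suc k + q ^ (2 * Suc k))"
proof -
  obtain Q where Q: "Q \<noteq> 0" "qfact q \<longlonglongrightarrow> Q" using qfact_limit[OF q] .
  have "Bseq (qfact q)" using Q(2) by (blast intro: convergent_imp_Bseq convergentI)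
  then obtain B where B: "\<And>n. norm (qfact q n) \<le> B" by (auto simp: Bseq_def)
  have inv: "(\<lambda>n. 1 / qfact q n) \<longlonglongrightarrow> 1 / Q" by (intro tendsto_intros Q)
  then have "Bseq (\<lambda>n. 1 / qfact q n)" by (blast intro: convergent_imp_Bseq convergentI)
  then obtain B' where B': "\<And>n. norm (1 / qfact q n) \<le> B'" by (auto simp: Bseq_def)
  have B'0: "B' \<ge> 0" "B \<ge> 0" using B'[of 0] B[of 0] norm_ge_zero order_trans by blast+
  have Bi: "norm (inv_qfact q k) \<le> B'" for k using B' B'0 by (simp add: inv_qfact_def)
  have tri: "nat (int n * (int n + 1) div 2) = n * (n + 1) div 2" for n
    by (simp add: nat_div_distrib nat_mult_distrib nat_add_distrib)
  have "(\<Sum>n. (- 1) ^ n * q ^ (n * (n + 1) div 2) * s n) = Q * s 0 * (\<Prod>k. 1 - w * q ^ Suc k + q ^ (2 * Suc k))"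
    if s: "s 1 = (w + 1) * s 0" "\<And>n. s (Suc (Suc n)) = w * s (Suc n) - s n"
       "summable (\<lambda>n. norm (q ^ (n * (n + 1) div 2) * s n))" for w s
  proof -
    have "(\<lambda>m. \<Sum>n. triple_coeff q m (int n) * s n) \<longlonglongrightarrow> 
        (\<Sum>n. (- 1) ^ n * q ^ (n * (n + 1) div 2) * (Q * (1 / Q) * (1 / Q)) * s n)"
    proof (rule tannerys_theorem[THEN conjunct2, THEN conjunct2])
      fix n
      have "(\<lambda>m. inv_qfact q (int m - int n)) \<longlonglongrightarrow> 1 / Q"
        by (rule LIMSEQ_offset[of _ n]) (use inv in \<open>simp add: inv_qfact_def\<close>)
      moreover have "(\<lambda>m. inv_qfact q (int m + int n + 1)) \<longlonglongrightarrow> 1 / Q"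
        using LIMSEQ_ignore_initial_segment[OF inv, of "n + 1"] 
        by (simp add: inv_qfact_def nat_add_distrib add.assoc)
      moreover have "(\<lambda>m. qfact q (2 * m + 1)) \<longlonglongrightarrow> Q"
        by (rule filterlim_compose[OF Q(2)]) (simp add: filterlim_subseq strict_mono_def)
      ultimately show "(\<lambda>m. triple_coeff q m (int n) * s n) \<longlonglongrightarrow> 
          (- 1) ^ n * q ^ (n * (n + 1) div 2) * (Q * (1 / Q) * (1 / Q)) * s n"
        unfolding triple_coeff_def tri even_of_nat minus_one_power_iff
        by (intro tendsto_intros)
    next
      show "summable (\<lambda>n. B * B' * B' * norm (q ^ (n * (n + 1) div 2) * s n))"
        by (intro summable_mult s)
    next
      have "norm (triple_coeff q m (int n) * s n) \<le> B * B' * B' * norm (q ^ (n * (n + 1) div 2) * s n)" for m n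
      proof -
        have "norm (qfact q (2 * m + 1) * inv_qfact q (int m - int n) * inv_qfact q (int m + int n + 1)) \<le> B * B' * B'"
          unfolding norm_mult by (intro mult_mono B Bi mult_nonneg_nonneg B'0 norm_ge_zero)
        then have "norm (q ^ (n * (n + 1) div 2) * s n) * 
             norm (qfact q (2 * m + 1) * inv_qfact q (int m - int n) * inv_qfact q (int m + int n + 1))
             \<le> norm (q ^ (n * (n + 1) div 2) * s n) * (B * B' * B')"
          by (intro mult_left_mono) auto
        moreover have "norm (triple_coeff q m (int n) * s n) = norm (q ^ (n * (n + 1) div 2) * s n) *
             norm (qfact q (2 * m + 1) * inv_qfact q (int m - int n) * inv_qfact q (int m + int n + 1))"
        proof -
          have "norm (if even (int n) then 1 else - 1 :: complex) = 1" by simp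
          then show ?thesis unfolding triple_coeff_def tri norm_mult[of "_ * _ * _" "s n"] 
              norm_mult[of "_ * _" "_ * _ * _"] norm_mult[of "if _ then _ else _"]
            unfolding norm_mult[of "_ ^ _" "s n"] by simp
        qed
        ultimately show ?thesis by (simp only: mult.commute)
      qed
      then show "eventually (\<lambda>(n, m). norm (triple_coeff q m (int n) * s n) 
          \<le> B * B' * B' * norm (q ^ (n * (n + 1) div 2) * s n)) (at_top \<times>\<^sub>F sequentially)"
        by (intro always_eventually) auto
    qed auto
    also have "(\<lambda>m. \<Sum>n. triple_coeff q m (int n) * s n) = (\<lambda>m. s 0 * (\<Prod>k<m. 1 - w * q ^ Suc k + q ^ (2 * Suc k)))"
    proof
      fix m
      have "(\<Sum>n. triple_coeff q m (int n) * s n) = (\<Sum>n\<le>m. triple_coeff q m (int n) * s n)"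
        by (rule suminf_finite) (auto simp: triple_coeff_def inv_qfact_def)
      then show "(\<Sum>n. triple_coeff q m (int n) * s n) = s 0 * (\<Prod>k<m. 1 - w * q ^ Suc k + q ^ (2 * Suc k))"
        using finite_triple_product[OF q, of s w m] s by simp
    qed
    finally have L: "(\<lambda>m. s 0 * (\<Prod>k<m. 1 - w * q ^ Suc k + q ^ (2 * Suc k))) \<longlonglongrightarrow>
      (\<Sum>n. (- 1) ^ n * q ^ (n * (n + 1) div 2) * (Q * (1 / Q) * (1 / Q)) * s n)" .
    have "(\<lambda>m. \<Prod>k<Suc m. 1 - w * q ^ Suc k + q ^ (2 * Suc k)) \<longlonglongrightarrow> (\<Prod>k. 1 - w * q ^ Suc k + q ^ (2 * Suc k))"
      using convergent_prod_LIMSEQ[OF convergent_prod_one_plus_powers[OF q, of w]] by (simp only: lessThan_Suc_atMost)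
    then have "(\<lambda>m. \<Prod>k<m. 1 - w * q ^ Suc k + q ^ (2 * Suc k)) \<longlonglongrightarrow> (\<Prod>k. 1 - w * q ^ Suc k + q ^ (2 * Suc k))"
      by (rule LIMSEQ_imp_Suc)
    then have L2: "(\<lambda>m. s 0 * (\<Prod>k<m. 1 - w * q ^ Suc k + q ^ (2 * Suc k))) \<longlonglongrightarrow>
      s 0 * (\<Prod>k. 1 - w * q ^ Suc k + q ^ (2 * Suc k))" by (intro tendsto_intros)
    have sm: "summable (\<lambda>n. (- 1) ^ n * q ^ (n * (n + 1) div 2) * s n)"
      by (rule summable_norm_cancel) (use s(3) in \<open>simp add: norm_mult norm_power\<close>)
    have "s 0 * (\<Prod>k. 1 - w * q ^ Suc k + q ^ (2 * Suc k)) = 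
      (\<Sum>n. (- 1) ^ n * q ^ (n * (n + 1) div 2) * (Q * (1 / Q) * (1 / Q)) * s n)"
      using LIMSEQ_unique[OF L2 L] .
    also have "\<dots> = (\<Sum>n. (1 / Q) * ((- 1) ^ n * q ^ (n * (n + 1) div 2) * s n))"
      using Q(1) by (simp add: mult_ac)
    also have "\<dots> = (1 / Q) * (\<Sum>n. (- 1) ^ n * q ^ (n * (n + 1) div 2) * s n)"
      by (rule suminf_mult[OF sm])
    finally show ?thesis using Q(1) by (simp add: field_simps)
  qed
  then show ?thesis by (rule that[OF Q(1)])
qed

section \<open>The product of the odd theta function\<close>

lemma theta_nome_power:
  "exp (of_real pi * \<i> * ((of_int (2 * int n + 1))\<^sup>2 / 4 * \<tau>)) = 
     exp (of_real pi * \<i> * \<tau> / 4) * exp (2 * of_real pi * \<i> * \<tau>) ^ (n * (n + 1) div 2)"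
proof -
  have "real (n * (n + 1) div 2) = real n * (real n + 1) / 2"
    by (subst real_of_nat_div) (auto simp: algebra_simps)
  then have "complex_of_real (real (n * (n + 1) div 2)) = complex_of_real (real n * (real n + 1) / 2)" by (rule arg_cong)
  then have e: "of_nat (n * (n + 1) div 2) = (of_nat n * (of_nat n + 1) / 2 :: complex)" by simp
  show ?thesis unfolding exp_of_nat_mult[symmetric] exp_add[symmetric] e
    by (rule arg_cong[of _ _ exp]) (simp add: field_simps power2_eq_square)
qed

lemma theta_term_exp:
  "theta_term \<tau> z (int n) = exp (of_real pi * \<i> * \<tau> / 4) * 
     ((- 1) ^ n * exp (2 * of_real pi * \<i> * \<tau>) ^ (n * (n + 1) div 2) * exp (\<i> * (of_nat (2 * n + 1) * of_real pi * z)))"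
  "theta_term \<tau> z (- 1 - int n) = - exp (of_real pi * \<i> * \<tau> / 4) * 
     ((- 1) ^ n * exp (2 * of_real pi * \<i> * \<tau>) ^ (n * (n + 1) div 2) * exp (- (\<i> * (of_nat (2 * n + 1) * of_real pi * z))))"
proof -
  have a: "theta_term \<tau> z (int n) = (- 1) ^ n * exp (of_real pi * \<i> * ((of_int (2 * int n + 1))\<^sup>2 / 4 * \<tau>)) * 
      exp (\<i> * (of_nat (2 * n + 1) * of_real pi * z))"
    unfolding theta_term_def mult.assoc exp_add[symmetric] by (simp add: algebra_simps minus_one_power_iff)
  show "theta_term \<tau> z (int n) = exp (of_real pi * \<i> * \<tau> / 4) * 
     ((- 1) ^ n * exp (2 * of_real pi * \<i> * \<tau>) ^ (n * (n + 1) div 2) * exp (\<i> * (of_nat (2 * n + 1) * of_real pi * z)))"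
    unfolding a theta_nome_power by (simp add: mult_ac)
  have b: "theta_term \<tau> z (- 1 - int n) = - ((- 1) ^ n * exp (of_real pi * \<i> * ((of_int (2 * int n + 1))\<^sup>2 / 4 * \<tau>)) * 
      exp (- (\<i> * (of_nat (2 * n + 1) * of_real pi * z))))"
    unfolding theta_term_def mult.assoc exp_add[symmetric] 
    by (simp add: algebra_simps minus_one_power_iff power2_eq_square)
  show "theta_term \<tau> z (- 1 - int n) = - exp (of_real pi * \<i> * \<tau> / 4) * 
     ((- 1) ^ n * exp (2 * of_real pi * \<i> * \<tau>) ^ (n * (n + 1) div 2) * exp (- (\<i> * (of_nat (2 * n + 1) * of_real pi * z))))"
    unfolding b theta_nome_power by (simp add: mult_ac)
qed

text \<open>
  The quadratic factors as \<open>(c - cis t) * (c - cis (- t))\<close>, with both roots on the unit circle.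
\<close>

lemma triple_factor_nonzero:
  fixes c :: complex
  assumes "norm c < 1"
  shows "1 - of_real (2 * cos t) * c + c\<^sup>2 \<noteq> 0"
proof
  assume 0: "1 - of_real (2 * cos t) * c + c\<^sup>2 = 0"
  have "cis t + cis (- t) = of_real (2 * cos t)" "cis t * cis (- t) = 1"
    by (auto simp: complex_eq_iff cis_mult)
  moreover have "(c - cis t) * (c - cis (- t)) = cis t * cis (- t) - (cis t + cis (- t)) * c + c\<^sup>2"
    by (simp add: algebra_simps power2_eq_square)
  ultimately have "(c - cis t) * (c - cis (- t)) = 0" using 0 by simp
  then have "norm c = 1" by auto
  then show False using assms by simp
qed

lemma norm_nome:
  assumes "Im \<tau> > 0" shows "norm (exp (2 * of_real pi * \<i> * \<tau>)) < 1"
  using assms by simp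

lemma theta_product:
  assumes "Im \<tau> > 0"
  defines "q \<equiv> exp (2 * of_real pi * \<i> * \<tau>)"
  obtains K where "K \<noteq> 0"
    "\<And>x::real. theta \<tau> (of_real x) = 
       K * of_real (sin (pi * x)) * (\<Prod>k. 1 - of_real (2 * cos (2 * pi * x)) * q ^ Suc k + q ^ (2 * Suc k))"
    "theta_deriv 1 \<tau> 0 = K * of_real pi * (\<Prod>k. 1 - 2 * q ^ Suc k + q ^ (2 * Suc k))"
proof -
  have q: "norm q < 1" using norm_nome[OF assms(1)] by (simp add: q_def)
  define c0 where "c0 = exp (of_real pi * \<i> * \<tau> / 4)"
  obtain Q where Q: "Q \<noteq> 0" "\<And>w s. s 1 = (w + 1) * s 0 \<Longrightarrow> (\<And>n. s (Suc (Suc n)) = w * s (Suc n) - s n) \<Longrightarrow>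
       summable (\<lambda>n. norm (q ^ (n * (n + 1) div 2) * s n)) \<Longrightarrow>
       (\<Sum>n. (- 1) ^ n * q ^ (n * (n + 1) div 2) * s n) = Q * s 0 * (\<Prod>k. 1 - w * q ^ Suc k + q ^ (2 * Suc k))"
    by (rule triple_product[OF q]) blast
  have sm: "summable (\<lambda>n. norm (q ^ (n * (n + 1) div 2) * s n))" if s: "\<And>n. norm (s n) \<le> real (2 * n + 1)" for s
  proof (rule summable_comparison_test'[where N = 0])
    have "(\<lambda>n. of_nat (Suc n) * norm q ^ n) sums (1 / (1 - norm q)\<^sup>2)"
      by (rule geometric_deriv_sums) (use q in auto)
    then show "summable (\<lambda>n. 2 * (of_nat (Suc n) * norm q ^ n))"
      by (intro summable_mult) (auto simp: sums_iff)
    fix n :: nat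
    have "n \<le> n * (n + 1) div 2" by (cases n) auto
    then have "norm q ^ (n * (n + 1) div 2) \<le> norm q ^ n"
      using q by (intro power_decreasing) auto
    then have "norm q ^ (n * (n + 1) div 2) * norm (s n) \<le> norm q ^ n * real (2 * n + 1)"
      using s[of n] by (intro mult_mono) auto
    also have "\<dots> \<le> norm q ^ n * (2 * real (Suc n))" by (intro mult_left_mono) auto
    finally show "norm (norm (q ^ (n * (n + 1) div 2) * s n)) \<le> 2 * (of_nat (Suc n) * norm q ^ n)"
      by (simp only: norm_mult norm_power real_norm_def abs_norm_cancel abs_mult power_abs) (simp add: algebra_simps)
  qed
  have th: "theta \<tau> (of_real x) = 2 * \<i> * c0 * Q * of_real (sin (pi * x)) * (\<Prod>k. 1 - of_real (2 * cos (2 * pi * x)) * q ^ Suc k + q ^ (2 * Suc k))"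
    for x :: real
  proof -
    define s where "s n = complex_of_real (sin (real (2 * n + 1) * pi * x))" for n
    have s1: "s 1 = (of_real (2 * cos (2 * pi * x)) + 1) * s 0"
    proof -
      have "sin (3 * (pi * x)) = (2 * cos (2 * (pi * x)) + 1) * sin (pi * x)"
      proof -
        define a where "a = pi * x"
        have "sin (a + b) = 2 * cos b * sin a - sin (a - b)" for b by (simp add: sin_add sin_diff)
        from this[of "2 * a"] show ?thesis by (simp add: a_def algebra_simps)
      qed
      moreover have "s 1 = complex_of_real (sin (3 * (pi * x)))" "s 0 = complex_of_real (sin (pi * x))"
        by (simp_all add: s_def mult.assoc)
      ultimately show ?thesis by (simp add: mult.assoc)
    qed
    have s2: "s (Suc (Suc n)) = of_real (2 * cos (2 * pi * x)) * s (Suc n) - s n" for n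
    proof -
      define b where "b = real (2 * n + 3) * pi * x"
      have 1: "real (2 * Suc (Suc n) + 1) * pi * x = b + 2 * pi * x" 
        "real (2 * n + 1) * pi * x = b - 2 * pi * x" "real (2 * Suc n + 1) * pi * x = b"
        by (simp_all add: b_def algebra_simps)
      have "sin (b + 2 * pi * x) = 2 * cos (2 * pi * x) * sin b - sin (b - 2 * pi * x)"
        by (simp add: sin_add sin_diff)
      then show ?thesis unfolding s_def 1 by (metis of_real_mult of_real_diff)
    qed
    have s3: "norm (s n) \<le> real (2 * n + 1)" for n
    proof -
      have "norm (s n) \<le> 1" by (simp add: s_def)
      then show ?thesis by simp
    qed
    have "(\<lambda>n. theta_term \<tau> (of_real x) (int n) + theta_term \<tau> (of_real x) (- 1 - int n)) sums theta \<tau> (of_real x)"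
      using infsum_int_sums[OF theta_summable[OF assms(1), of 0 "of_real x"]] by (simp add: theta_deriv_def)
    moreover have "theta_term \<tau> (of_real x) (int n) + theta_term \<tau> (of_real x) (- 1 - int n) = 
       2 * \<i> * c0 * ((- 1) ^ n * q ^ (n * (n + 1) div 2) * s n)" for n
    proof -
      have "s n = sin (of_nat (2 * n + 1) * of_real pi * of_real x)"
        by (simp add: s_def flip: sin_of_real)
      moreover define e1 where "e1 = exp (\<i> * (of_nat (2 * n + 1) * of_real pi * of_real x))"
      moreover define e2 where "e2 = exp (- (\<i> * (of_nat (2 * n + 1) * of_real pi * of_real x)))"
      ultimately have e: "e1 = e2 + 2 * \<i> * s n" by (simp add: sin_exp_eq)
      show ?thesis
        unfolding theta_term_exp q_def[symmetric] c0_def[symmetric] e1_def[symmetric] e2_def[symmetric] e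
        by (simp add: algebra_simps)
    qed
    ultimately have "(\<lambda>n. 2 * \<i> * c0 * ((- 1) ^ n * q ^ (n * (n + 1) div 2) * s n)) sums theta \<tau> (of_real x)" by simp
    then have "theta \<tau> (of_real x) = (\<Sum>n. 2 * \<i> * c0 * ((- 1) ^ n * q ^ (n * (n + 1) div 2) * s n))"
      by (rule sums_unique)
    also have "\<dots> = 2 * \<i> * c0 * (\<Sum>n. (- 1) ^ n * q ^ (n * (n + 1) div 2) * s n)"
      by (rule suminf_mult, rule summable_norm_cancel) (use sm[OF s3] in \<open>simp add: norm_mult norm_power\<close>)
    also have "\<dots> = 2 * \<i> * c0 * (Q * s 0 * (\<Prod>k. 1 - of_real (2 * cos (2 * pi * x)) * q ^ Suc k + q ^ (2 * Suc k)))"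
      by (simp only: Q(2)[OF s1 s2 sm[OF s3]])
    also have "s 0 = of_real (sin (pi * x))" by (simp add: s_def)
    finally show ?thesis by (simp only: mult.assoc)
  qed
  have d: "theta_deriv 1 \<tau> 0 = 2 * \<i> * c0 * Q * of_real pi * (\<Prod>k. 1 - 2 * q ^ Suc k + q ^ (2 * Suc k))"
  proof -
    define s where "s n = complex_of_real (real (2 * n + 1))" for n
    have s1: "s 1 = (2 + 1) * s 0" and s2: "s (Suc (Suc n)) = 2 * s (Suc n) - s n" for n
      by (simp_all add: s_def)
    have s3: "norm (s n) \<le> real (2 * n + 1)" for n unfolding s_def norm_of_real by simp
    have "(\<lambda>n. of_int (2 * int n + 1) * of_real pi * \<i> * theta_term \<tau> 0 (int n) + 
         of_int (2 * (- 1 - int n) + 1) * of_real pi * \<i> * theta_term \<tau> 0 (- 1 - int n)) sums theta_deriv 1 \<tau> 0"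
      using infsum_int_sums[OF theta_summable[OF assms(1), of 1 0]] unfolding theta_deriv_def power_one_right .
    moreover have "of_int (2 * int n + 1) * of_real pi * \<i> * theta_term \<tau> 0 (int n) + 
         of_int (2 * (- 1 - int n) + 1) * of_real pi * \<i> * theta_term \<tau> 0 (- 1 - int n) = 
       2 * \<i> * c0 * of_real pi * ((- 1) ^ n * q ^ (n * (n + 1) div 2) * s n)" for n
      unfolding theta_term_exp q_def[symmetric] c0_def[symmetric] by (simp add: s_def algebra_simps)
    ultimately have "(\<lambda>n. 2 * \<i> * c0 * of_real pi * ((- 1) ^ n * q ^ (n * (n + 1) div 2) * s n)) sums theta_deriv 1 \<tau> 0" by simp
    then have "theta_deriv 1 \<tau> 0 = (\<Sum>n. 2 * \<i> * c0 * of_real pi * ((- 1) ^ n * q ^ (n * (n + 1) div 2) * s n))"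
      by (rule sums_unique)
    also have "\<dots> = 2 * \<i> * c0 * of_real pi * (\<Sum>n. (- 1) ^ n * q ^ (n * (n + 1) div 2) * s n)"
      by (rule suminf_mult, rule summable_norm_cancel) (use sm[OF s3] in \<open>simp add: norm_mult norm_power\<close>)
    also have "\<dots> = 2 * \<i> * c0 * of_real pi * (Q * s 0 * (\<Prod>k. 1 - 2 * q ^ Suc k + q ^ (2 * Suc k)))"
      by (simp only: Q(2)[OF s1 s2 sm[OF s3]])
    also have "s 0 = 1" by (simp add: s_def)
    finally show ?thesis by (simp only: mult_ac mult_1_right mult_1_left)
  qed
  show ?thesis
    by (rule that[OF _ th d]) (use Q(1) in \<open>simp add: c0_def\<close>)
qed

lemma theta_prod_nonzero:
  assumes "norm (q::complex) < 1"
  shows "(\<Prod>k. 1 - of_real (2 * cos t) * q ^ Suc k + q ^ (2 * Suc k)) \<noteq> 0"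
proof (rule prodinf_nonzero[OF convergent_prod_one_plus_powers[OF assms]])
  fix k
  have "norm (q ^ Suc k) < 1" using assms by (simp add: norm_power power_less_one_iff del: power_Suc)
  from triple_factor_nonzero[OF this, of t]
  show "1 - of_real (2 * cos t) * q ^ Suc k + q ^ (2 * Suc k) \<noteq> 0"
    unfolding power_mult[symmetric] mult.commute[of "Suc k" 2] .
qed

text \<open>
  On the real axis the theta function vanishes only at the integers, since no factor of its product vanishes.
\<close>

lemma theta_nonzero:
  assumes "Im \<tau> > 0" "sin (pi * x) \<noteq> 0"
  shows "theta \<tau> (of_real x) \<noteq> 0"
proof -
  obtain K where K: "K \<noteq> 0" "\<And>x::real. theta \<tau> (of_real x) = 
       K * of_real (sin (pi * x)) * (\<Prod>k. 1 - of_real (2 * cos (2 * pi * x)) * exp (2 * of_real pi * \<i> * \<tau>) ^ Suc k 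
        + exp (2 * of_real pi * \<i> * \<tau>) ^ (2 * Suc k))"
    by (rule theta_product[OF assms(1)]) blast
  show ?thesis unfolding K(2) using K(1) assms(2) theta_prod_nonzero[OF norm_nome[OF assms(1)]] 
    by (simp del: power_Suc)
qed

lemma theta_deriv_one_nonzero:
  assumes "Im \<tau> > 0"
  shows "theta_deriv 1 \<tau> 0 \<noteq> 0"
proof -
  obtain K where K: "K \<noteq> 0" "theta_deriv 1 \<tau> 0 = 
       K * of_real pi * (\<Prod>k. 1 - 2 * exp (2 * of_real pi * \<i> * \<tau>) ^ Suc k 
        + exp (2 * of_real pi * \<i> * \<tau>) ^ (2 * Suc k))"
    by (rule theta_product[OF assms(1)]) blast
  show ?thesis unfolding K(2) using K(1) theta_prod_nonzero[OF norm_nome[OF assms(1)], of 0] 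
    by (simp del: power_Suc)
qed

section \<open>Addition and duplication\<close>

text \<open>
  The logarithmic derivative of the theta function, then minus its derivative and the next two derivatives,
  written in terms of the quotients of theta derivatives. Thus \<open>theta_zeta\<close> is the Weierstrass zeta function up to a
  linear term, and \<open>theta_wp\<close> is the Weierstrass function \<open>\<wp>\<close> up to an additive constant depending on \<open>\<tau>\<close>.
\<close>

definition theta_zeta :: "complex \<Rightarrow> complex \<Rightarrow> complex" where
  "theta_zeta \<tau> z = theta_deriv 1 \<tau> z / theta \<tau> z"

definition theta_wp :: "complex \<Rightarrow> complex \<Rightarrow> complex" where
  "theta_wp \<tau> z = (theta_zeta \<tau> z)\<^sup>2 - theta_deriv 2 \<tau> z / theta \<tau> z"

definition theta_wp' :: "complex \<Rightarrow> complex \<Rightarrow> complex" where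
  "theta_wp' \<tau> z = 3 * theta_zeta \<tau> z * (theta_deriv 2 \<tau> z / theta \<tau> z) - 2 * theta_zeta \<tau> z ^ 3
      - theta_deriv 3 \<tau> z / theta \<tau> z"

definition theta_wp'' :: "complex \<Rightarrow> complex \<Rightarrow> complex" where
  "theta_wp'' \<tau> z = 3 * (theta_deriv 2 \<tau> z / theta \<tau> z)\<^sup>2 
      - 12 * (theta_zeta \<tau> z)\<^sup>2 * (theta_deriv 2 \<tau> z / theta \<tau> z)
      + 4 * theta_zeta \<tau> z * (theta_deriv 3 \<tau> z / theta \<tau> z) + 6 * theta_zeta \<tau> z ^ 4
      - theta_deriv 4 \<tau> z / theta \<tau> z"

lemma theta_deriv_z':
  assumes "Im \<tau> > 0"
  shows "(theta \<tau> has_field_derivative theta_deriv 1 \<tau> z) (at z)"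
    "(theta_deriv 1 \<tau> has_field_derivative theta_deriv 2 \<tau> z) (at z)"
    "(theta_deriv 2 \<tau> has_field_derivative theta_deriv 3 \<tau> z) (at z)"
    "(theta_deriv 3 \<tau> has_field_derivative theta_deriv 4 \<tau> z) (at z)"
  using theta_deriv_z[OF assms, of 0 z] theta_deriv_z[OF assms, of 1 z] theta_deriv_z[OF assms, of 2 z] 
     theta_deriv_z[OF assms, of 3 z] by (simp_all add: numeral_eq_Suc)

lemmas theta_deriv_chain = theta_deriv_z'[THEN DERIV_chain2]

lemma theta_quotient_deriv:
  assumes "Im \<tau> > 0" "theta \<tau> z \<noteq> 0"
  shows "((\<lambda>z. theta_deriv k \<tau> z / theta \<tau> z) has_field_derivative 
     theta_deriv (Suc k) \<tau> z / theta \<tau> z - theta_deriv k \<tau> z / theta \<tau> z * theta_zeta \<tau> z) (at z)"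
  by (rule DERIV_cong[OF DERIV_divide[OF theta_deriv_z[OF assms(1)] theta_deriv_z'(1)[OF assms(1)] assms(2)]])
     (use assms(2) in \<open>simp add: theta_zeta_def field_simps\<close>)

lemma theta_quotient_tau_deriv:
  assumes "Im \<tau> > 0" "theta \<tau> z \<noteq> 0"
  shows "((\<lambda>\<tau>. theta_deriv k \<tau> z / theta \<tau> z) has_field_derivative 
     (theta_deriv (k + 2) \<tau> z / theta \<tau> z - theta_deriv k \<tau> z / theta \<tau> z * (theta_deriv 2 \<tau> z / theta \<tau> z))
       / (4 * of_real pi * \<i>)) (at \<tau>)"
  by (rule DERIV_cong[OF DERIV_divide[OF theta_deriv_tau[OF assms(1)] theta_deriv_tau[OF assms(1)] assms(2)]])
     (use assms(2) in \<open>simp add: divide_simps numeral_2_eq_2\<close>)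

lemma theta_zeta_deriv:
  assumes "Im \<tau> > 0" "theta \<tau> z \<noteq> 0"
  shows "(theta_zeta \<tau> has_field_derivative - theta_wp \<tau> z) (at z)"
  using theta_quotient_deriv[OF assms, of 1] 
  by (simp add: theta_wp_def theta_zeta_def[abs_def] power2_eq_square numeral_eq_Suc)

lemma theta_zeta_chain:
  assumes "Im \<tau> > 0" "(g has_field_derivative d) (at y)" "theta \<tau> (g y) \<noteq> 0"
  shows "((\<lambda>y. theta_zeta \<tau> (g y)) has_field_derivative - theta_wp \<tau> (g y) * d) (at y)"
  using DERIV_chain2[where f = "theta_zeta \<tau>", OF theta_zeta_deriv[OF assms(1,3)] assms(2)] .

lemma theta_wp_deriv:
  assumes "Im \<tau> > 0" "theta \<tau> z \<noteq> 0"
  shows "(theta_wp \<tau> has_field_derivative theta_wp' \<tau> z) (at z)"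
proof -
  have 3: "Suc 2 = 3" by simp
  show ?thesis unfolding theta_wp_def[abs_def]
    by (rule theta_zeta_deriv[OF assms] theta_quotient_deriv[OF assms] derivative_eq_intros refl)+
       (simp add: theta_wp'_def theta_wp_def 3 algebra_simps power2_eq_square power3_eq_cube)
qed

lemma theta_wp'_deriv:
  assumes "Im \<tau> > 0" "theta \<tau> z \<noteq> 0"
  shows "(theta_wp' \<tau> has_field_derivative theta_wp'' \<tau> z) (at z)"
proof -
  have 3: "Suc 2 = 3" "Suc 3 = 4" by simp_all
  show ?thesis unfolding theta_wp'_def[abs_def]
    by (rule theta_zeta_deriv[OF assms] theta_quotient_deriv[OF assms] derivative_eq_intros refl)+
       (simp add: theta_wp''_def theta_wp_def 3 algebra_simps power2_eq_square power3_eq_cube power4_eq_xxxx)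
qed

text \<open>
  Differentiate the heat equation, written for the logarithm of theta, in \<open>z\<close>.
\<close>

lemma theta_zeta_tau_deriv:
  assumes "Im \<tau> > 0" "theta \<tau> z \<noteq> 0"
  shows "((\<lambda>\<tau>. theta_zeta \<tau> z) has_field_derivative 
      - (theta_wp' \<tau> z + 2 * theta_zeta \<tau> z * theta_wp \<tau> z) / (4 * of_real pi * \<i>)) (at \<tau>)"
proof -
  have 3: "1 + 2 = (3::nat)" by simp
  show ?thesis
    unfolding theta_zeta_def
    by (rule DERIV_cong[OF theta_quotient_tau_deriv[OF assms, of 1, unfolded 3]])
       (simp add: theta_wp'_def theta_wp_def theta_zeta_def algebra_simps power2_eq_square power3_eq_cube)
qed

lemma theta_wp_tau_deriv:
  assumes "Im \<tau> > 0" "theta \<tau> z \<noteq> 0"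
  shows "((\<lambda>\<tau>. theta_wp \<tau> z) has_field_derivative 
      (theta_wp'' \<tau> z - 2 * (theta_wp \<tau> z)\<^sup>2 + 2 * theta_zeta \<tau> z * theta_wp' \<tau> z) / (4 * of_real pi * \<i>)) (at \<tau>)"
proof -
  have 4: "2 + 2 = (4::nat)" by simp
  show ?thesis unfolding theta_wp_def
    by (rule theta_zeta_tau_deriv[OF assms] theta_quotient_tau_deriv[OF assms, of 2, unfolded 4] derivative_eq_intros refl)+
       (simp add: theta_wp''_def theta_wp'_def theta_wp_def algebra_simps add_divide_distrib diff_divide_distrib power2_eq_square power3_eq_cube power4_eq_xxxx)
qed

text \<open>
  The second derivative of the three-term relation in \<open>v\<close> at \<open>v = 0\<close>. Divided by the squares of \<open>theta \<tau> x\<close> and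
  \<open>theta \<tau> y\<close> it becomes the classical factorisation of \<open>\<wp> x - \<wp> y\<close>, which is \<open>theta_wp_diff\<close>.
\<close>

lemma theta_addition:
  assumes t: "Im \<tau> > 0"
  shows "(theta_deriv 1 \<tau> 0)\<^sup>2 * (theta \<tau> (x + y) * theta \<tau> (x - y)) =
     (theta \<tau> x)\<^sup>2 * ((theta_deriv 1 \<tau> y)\<^sup>2 - theta \<tau> y * theta_deriv 2 \<tau> y)
   - (theta \<tau> y)\<^sup>2 * ((theta_deriv 1 \<tau> x)\<^sup>2 - theta \<tau> x * theta_deriv 2 \<tau> x)"
proof -
  let ?T = "\<lambda>k. theta_deriv k \<tau>"
  define F where "F = ?T 0 (x + y) * ?T 0 (x - y)"
  define g0 where "g0 v = (?T 0 v)\<^sup>2 * F + (?T 0 x)\<^sup>2 * (?T 0 (y + v) * ?T 0 (y - v)) 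
     + (?T 0 y)\<^sup>2 * (?T 0 (v + x) * ?T 0 (v - x))" for v
  define g1 where "g1 v = 2 * ?T 0 v * ?T 1 v * F 
     + (?T 0 x)\<^sup>2 * (?T 1 (y + v) * ?T 0 (y - v) - ?T 0 (y + v) * ?T 1 (y - v)) 
     + (?T 0 y)\<^sup>2 * (?T 1 (v + x) * ?T 0 (v - x) + ?T 0 (v + x) * ?T 1 (v - x))" for v
  define g2 where "g2 = 2 * (?T 1 0)\<^sup>2 * F 
     + (?T 0 x)\<^sup>2 * (2 * ?T 2 y * ?T 0 y - 2 * (?T 1 y)\<^sup>2) 
     + (?T 0 y)\<^sup>2 * (?T 2 x * ?T 0 (- x) + 2 * ?T 1 x * ?T 1 (- x) + ?T 0 x * ?T 2 (- x))"
  \<comment> \<open>The relation reads \<open>g0 = 0\<close>; its first and second derivatives in \<open>v\<close> are \<open>g1\<close> and, at \<open>v = 0\<close>, \<open>g2\<close>.\<close>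
  have z0: "?T 0 0 = 0" using theta_deriv_minus[of 0 \<tau> 0] by simp
  have g0: "g0 v = 0" for v using theta_three_term[OF t, of v x y] by (simp add: g0_def F_def)
  have d0: "(g0 has_field_derivative g1 v) (at v)" for v
    unfolding g0_def[abs_def]
    by (rule derivative_eq_intros theta_deriv_chain[OF t] refl)+ (simp add: g1_def algebra_simps)
  have g1: "g1 v = 0" for v
    using d0[of v] DERIV_const[of 0 "at v"] DERIV_unique unfolding g0 by (metis (no_types, lifting) ext g0)
  have d1: "(g1 has_field_derivative g2) (at 0)"
    unfolding g1_def[abs_def]
    by (rule derivative_eq_intros theta_deriv_chain[OF t] refl)+ (simp add: g2_def z0 algebra_simps power2_eq_square)
  have g2: "g2 = 0"
    using d1 DERIV_const[of 0 "at 0"] DERIV_unique by (metis (no_types, lifting) ext g1)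
  have "?T 0 (- x) = - ?T 0 x" "?T 1 (- x) = ?T 1 x" "?T 2 (- x) = - ?T 2 x"
    by (simp_all add: theta_deriv_minus)
  then have "2 * ((?T 1 0)\<^sup>2 * F - ((?T 0 x)\<^sup>2 * ((?T 1 y)\<^sup>2 - ?T 0 y * ?T 2 y) - (?T 0 y)\<^sup>2 * ((?T 1 x)\<^sup>2 - ?T 0 x * ?T 2 x))) = g2"
    unfolding g2_def by (simp add: algebra_simps power2_eq_square)
  then show ?thesis unfolding g2 F_def mult_eq_0_iff right_minus_eq by simp
qed

lemma theta_addition_deriv:
  assumes t: "Im \<tau> > 0"
  shows "(theta_deriv 1 \<tau> 0)\<^sup>2 * (theta_deriv 1 \<tau> (x + y) * theta \<tau> (x - y) + theta \<tau> (x + y) * theta_deriv 1 \<tau> (x - y)) =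
     2 * theta \<tau> x * theta_deriv 1 \<tau> x * ((theta_deriv 1 \<tau> y)\<^sup>2 - theta \<tau> y * theta_deriv 2 \<tau> y)
   - (theta \<tau> y)\<^sup>2 * (theta_deriv 1 \<tau> x * theta_deriv 2 \<tau> x - theta \<tau> x * theta_deriv 3 \<tau> x)"
proof -
  let ?T = "\<lambda>k. theta_deriv k \<tau>"
  have "((\<lambda>x. (?T 1 0)\<^sup>2 * (?T 0 (x + y) * ?T 0 (x - y))) has_field_derivative
     (?T 1 0)\<^sup>2 * (?T 1 (x + y) * ?T 0 (x - y) + ?T 0 (x + y) * ?T 1 (x - y))) (at x)"
    by (rule derivative_eq_intros theta_deriv_chain[OF t] refl)+ (simp add: algebra_simps)
  moreover have "((\<lambda>x. (?T 1 0)\<^sup>2 * (?T 0 (x + y) * ?T 0 (x - y))) has_field_derivative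
     2 * ?T 0 x * ?T 1 x * ((?T 1 y)\<^sup>2 - ?T 0 y * ?T 2 y)
   - (?T 0 y)\<^sup>2 * (?T 1 x * ?T 2 x - ?T 0 x * ?T 3 x)) (at x)"
    unfolding theta_addition[OF t]
    by (rule derivative_eq_intros theta_deriv_chain[OF t] refl)+ (simp add: algebra_simps power2_eq_square)
  ultimately show ?thesis by (rule DERIV_unique)
qed

lemma theta_deriv_eqs:
  assumes "theta \<tau> z \<noteq> 0"
  shows "theta_deriv 1 \<tau> z = theta_zeta \<tau> z * theta \<tau> z"
    "theta_deriv 2 \<tau> z = ((theta_zeta \<tau> z)\<^sup>2 - theta_wp \<tau> z) * theta \<tau> z"
    "theta_deriv 3 \<tau> z = (3 * theta_zeta \<tau> z * ((theta_zeta \<tau> z)\<^sup>2 - theta_wp \<tau> z) - 2 * theta_zeta \<tau> z ^ 3 - theta_wp' \<tau> z) * theta \<tau> z"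
  using assms by (simp_all add: theta_zeta_def theta_wp_def theta_wp'_def)

lemma theta_wp_diff:
  assumes t: "Im \<tau> > 0" and x: "theta \<tau> x \<noteq> 0" and y: "theta \<tau> y \<noteq> 0"
  shows "(theta_deriv 1 \<tau> 0)\<^sup>2 * (theta \<tau> (x + y) * theta \<tau> (x - y)) = 
     (theta_wp \<tau> y - theta_wp \<tau> x) * (theta \<tau> x * theta \<tau> y)\<^sup>2"
  unfolding theta_addition[OF t] theta_deriv_eqs[OF x] theta_deriv_eqs[OF y] 
  by (simp add: algebra_simps power2_eq_square)

text \<open>
  The logarithmic derivative in \<open>x\<close> of the factorisation of \<open>\<wp> x - \<wp> y\<close>.
\<close>

lemma theta_wp'_eq:
  assumes t: "Im \<tau> > 0" and nz: "theta \<tau> x \<noteq> 0" "theta \<tau> y \<noteq> 0" "theta \<tau> (x + y) \<noteq> 0" "theta \<tau> (x - y) \<noteq> 0"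
  shows "theta_wp' \<tau> x = (theta_wp \<tau> x - theta_wp \<tau> y) * (theta_zeta \<tau> (x + y) + theta_zeta \<tau> (x - y) - 2 * theta_zeta \<tau> x)"
proof -
  define X where "X = theta \<tau> x"
  define Y where "Y = theta \<tau> y"
  have "(theta_zeta \<tau> (x + y) + theta_zeta \<tau> (x - y)) * ((theta_wp \<tau> y - theta_wp \<tau> x) * (X * Y)\<^sup>2) =
     (theta_deriv 1 \<tau> 0)\<^sup>2 * (theta_deriv 1 \<tau> (x + y) * theta \<tau> (x - y) + theta \<tau> (x + y) * theta_deriv 1 \<tau> (x - y))"
    unfolding X_def Y_def theta_wp_diff[OF t nz(1,2), symmetric] theta_deriv_eqs[OF nz(3)] theta_deriv_eqs[OF nz(4)]
    by (simp add: algebra_simps)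
  also have "\<dots> = (X * Y)\<^sup>2 * (2 * theta_zeta \<tau> x * theta_wp \<tau> y - theta_wp' \<tau> x - 2 * theta_zeta \<tau> x * theta_wp \<tau> x)"
    unfolding theta_addition_deriv[OF t] theta_deriv_eqs[OF nz(1)] theta_deriv_eqs[OF nz(2)] X_def[symmetric] Y_def[symmetric]
    by (simp add: algebra_simps power2_eq_square power3_eq_cube)
  finally have "(X * Y)\<^sup>2 * ((theta_zeta \<tau> (x + y) + theta_zeta \<tau> (x - y)) * (theta_wp \<tau> y - theta_wp \<tau> x)) =
      (X * Y)\<^sup>2 * (2 * theta_zeta \<tau> x * theta_wp \<tau> y - theta_wp' \<tau> x - 2 * theta_zeta \<tau> x * theta_wp \<tau> x)"
    by (simp only: mult.commute mult.assoc mult.left_commute)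
  moreover have "(X * Y)\<^sup>2 \<noteq> 0" using nz by (simp add: X_def Y_def)
  ultimately have "(theta_zeta \<tau> (x + y) + theta_zeta \<tau> (x - y)) * (theta_wp \<tau> y - theta_wp \<tau> x) =
      2 * theta_zeta \<tau> x * theta_wp \<tau> y - theta_wp' \<tau> x - 2 * theta_zeta \<tau> x * theta_wp \<tau> x"
    by (metis mult_left_cancel)
  then show ?thesis by (simp add: algebra_simps)
qed

text \<open>
  The left-hand side of the preceding identity does not involve \<open>y\<close>, so its right-hand side has derivative zero in \<open>y\<close>.
\<close>

lemma theta_wp'_other_eq:
  assumes t: "Im \<tau> > 0" and nz: "theta \<tau> x \<noteq> 0" "theta \<tau> y \<noteq> 0" "theta \<tau> (x + y) \<noteq> 0" "theta \<tau> (x - y) \<noteq> 0"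
  shows "theta_wp' \<tau> y * (theta_zeta \<tau> (x + y) + theta_zeta \<tau> (x - y) - 2 * theta_zeta \<tau> x) =
     (theta_wp \<tau> x - theta_wp \<tau> y) * (theta_wp \<tau> (x - y) - theta_wp \<tau> (x + y))"
proof -
  define S where "S = {y. theta \<tau> y \<noteq> 0 \<and> theta \<tau> (x + y) \<noteq> 0 \<and> theta \<tau> (x - y) \<noteq> 0}"
  have c: "continuous_on A (theta \<tau>)" for A
    using theta_deriv_z'(1)[OF t] by (meson DERIV_continuous continuous_at_imp_continuous_on)
  have S: "open S"
    unfolding S_def
    by (intro open_Collect_conj open_Collect_neq continuous_intros c continuous_on_compose2[OF c]) auto
  have yS: "y \<in> S" using nz by (simp add: S_def)
  have z: "((\<lambda>y. theta_zeta \<tau> (x + y)) has_field_derivative - theta_wp \<tau> (x + y) * 1) (at y)"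
    "((\<lambda>y. theta_zeta \<tau> (x - y)) has_field_derivative - theta_wp \<tau> (x - y) * (- 1)) (at y)"
    by (rule theta_zeta_chain[OF t]; use nz in \<open>auto intro!: derivative_eq_intros\<close>)+
  have "((\<lambda>y. (theta_wp \<tau> x - theta_wp \<tau> y) * (theta_zeta \<tau> (x + y) + theta_zeta \<tau> (x - y) - 2 * theta_zeta \<tau> x)) 
      has_field_derivative 
      - theta_wp' \<tau> y * (theta_zeta \<tau> (x + y) + theta_zeta \<tau> (x - y) - 2 * theta_zeta \<tau> x) +
      (theta_wp \<tau> x - theta_wp \<tau> y) * (theta_wp \<tau> (x - y) - theta_wp \<tau> (x + y))) (at y)"
    by (rule theta_wp_deriv[OF t nz(2)] z
        derivative_eq_intros refl)+ (simp add: algebra_simps)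
  then have "((\<lambda>y. theta_wp' \<tau> x) has_field_derivative 
      - theta_wp' \<tau> y * (theta_zeta \<tau> (x + y) + theta_zeta \<tau> (x - y) - 2 * theta_zeta \<tau> x) +
      (theta_wp \<tau> x - theta_wp \<tau> y) * (theta_wp \<tau> (x - y) - theta_wp \<tau> (x + y))) (at y)"
    by (rule has_field_derivative_transform_within_open[OF _ S yS])
       (use theta_wp'_eq[OF t nz(1)] in \<open>auto simp: S_def\<close>)
  from DERIV_unique[OF this DERIV_const] show ?thesis by (simp add: algebra_simps)
qed

text \<open>
  The derivative in \<open>x\<close> of the factorisation of \<open>\<wp> x - \<wp> y\<close>, taken at \<open>y = x\<close>, where \<open>theta \<tau> (x - y)\<close> vanishes.
\<close>

lemma theta_duplication:
  assumes t: "Im \<tau> > 0" and x: "theta \<tau> x \<noteq> 0"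
  shows "theta_wp' \<tau> x * theta \<tau> x ^ 4 = - ((theta_deriv 1 \<tau> 0) ^ 3) * theta \<tau> (2 * x)"
proof -
  define X where "X = theta \<tau> x"
  have z0: "theta \<tau> 0 = 0" using theta_deriv_minus[of 0 \<tau> 0] by simp
  have "(theta_deriv 1 \<tau> 0)\<^sup>2 * (theta \<tau> (2 * x) * theta_deriv 1 \<tau> 0) = - (theta_wp' \<tau> x * theta \<tau> x ^ 4)"
    using theta_addition_deriv[OF t, of x x] unfolding theta_deriv_eqs[OF x] diff_self z0 mult_2[symmetric] X_def[symmetric]
    by (simp add: algebra_simps power2_eq_square power3_eq_cube power4_eq_xxxx)
  then show ?thesis by (simp add: algebra_simps power2_eq_square power3_eq_cube)
qed

text \<open>
  The logarithmic derivative of the duplication formula.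
\<close>

lemma theta_wp''_eq:
  assumes t: "Im \<tau> > 0" and x: "theta \<tau> x \<noteq> 0" "theta \<tau> (2 * x) \<noteq> 0"
  shows "theta_wp'' \<tau> x = theta_wp' \<tau> x * (2 * theta_zeta \<tau> (2 * x) - 4 * theta_zeta \<tau> x)"
proof -
  define S where "S = {x. theta \<tau> x \<noteq> 0}"
  have c: "continuous_on A (theta \<tau>)" for A
    using theta_deriv_z'(1)[OF t] by (meson DERIV_continuous continuous_at_imp_continuous_on)
  have S: "open S" unfolding S_def by (intro open_Collect_neq c continuous_intros)
  have xS: "x \<in> S" using x by (simp add: S_def)
  have "((\<lambda>x. - ((theta_deriv 1 \<tau> 0) ^ 3) * theta \<tau> (2 * x)) has_field_derivative 
      - ((theta_deriv 1 \<tau> 0) ^ 3) * (2 * theta_deriv 1 \<tau> (2 * x))) (at x)"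
    by (rule DERIV_cong[OF DERIV_cmult[OF theta_deriv_chain(1)[OF t DERIV_cmult[OF DERIV_ident]]]]) simp
  then have 1: "((\<lambda>x. theta_wp' \<tau> x * theta \<tau> x ^ 4) has_field_derivative 
      - ((theta_deriv 1 \<tau> 0) ^ 3) * (2 * theta_deriv 1 \<tau> (2 * x))) (at x)"
    by (rule has_field_derivative_transform_within_open[OF _ S xS])
       (simp add: S_def theta_duplication[OF t])
  have 2: "((\<lambda>x. theta_wp' \<tau> x * theta \<tau> x ^ 4) has_field_derivative 
     (theta_wp'' \<tau> x * theta \<tau> x ^ 4 + theta_wp' \<tau> x * (4 * theta \<tau> x ^ 3 * theta_deriv 1 \<tau> x))) (at x)"
    by (rule theta_wp'_deriv[OF t x(1)] theta_deriv_z'[OF t] derivative_eq_intros refl)+ (simp add: algebra_simps)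
  have "theta_wp'' \<tau> x * theta \<tau> x ^ 4 + theta_wp' \<tau> x * (4 * theta \<tau> x ^ 3 * theta_deriv 1 \<tau> x) = 
     - ((theta_deriv 1 \<tau> 0) ^ 3) * (2 * theta_deriv 1 \<tau> (2 * x))"
    by (rule DERIV_unique[OF 2 1])
  also have "\<dots> = - ((theta_deriv 1 \<tau> 0) ^ 3) * theta \<tau> (2 * x) * (2 * theta_zeta \<tau> (2 * x))"
    unfolding theta_deriv_eqs[OF x(2)] by simp
  also have "\<dots> = theta_wp' \<tau> x * theta \<tau> x ^ 4 * (2 * theta_zeta \<tau> (2 * x))"
    unfolding theta_duplication[OF t x(1), symmetric] ..
  finally have "theta \<tau> x ^ 4 * theta_wp'' \<tau> x = 
      theta \<tau> x ^ 4 * (theta_wp' \<tau> x * (2 * theta_zeta \<tau> (2 * x) - 4 * theta_zeta \<tau> x))"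
    unfolding theta_deriv_eqs[OF x(1)] by (simp add: algebra_simps power3_eq_cube power4_eq_xxxx)
  then show ?thesis using x(1) by simp
qed

lemma theta_parity_period:
  "theta \<tau> (- z) = - theta \<tau> z" "theta \<tau> (z + 1) = - theta \<tau> z"
  "theta_zeta \<tau> (- z) = - theta_zeta \<tau> z" "theta_zeta \<tau> (z + 1) = theta_zeta \<tau> z"
  "theta_wp \<tau> (- z) = theta_wp \<tau> z" "theta_wp \<tau> (z + 1) = theta_wp \<tau> z"
  by (simp_all add: theta_zeta_def theta_wp_def theta_deriv_minus theta_deriv_add_one)

section \<open>The points of order five\<close>

text \<open>
  At \<open>x = 1/5\<close> and \<open>y = 2/5\<close> the points \<open>x + y\<close>, \<open>x - y\<close>, \<open>2 x\<close> and \<open>2 y\<close> are again, up to sign and an integer,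
  the points \<open>x\<close> and \<open>y\<close>. So the identities for \<open>\<wp>'\<close> close up into relations between \<open>a\<close>, \<open>b\<close> and \<open>D\<close>, and two
  different expressions for \<open>\<wp>' y\<close> determine \<open>D\<close>. By duplication \<open>\<wp>' x\<close> is proportional to
  \<open>theta (2/5) / theta (1/5) ^ 4\<close> and \<open>\<wp>' y\<close> to \<open>theta (1/5) / theta (2/5) ^ 4\<close> with the same constant, which is
  why the quotient of these two values is the fifth power of the theta quotient.
\<close>

lemma fifth_torsion_relations:
  assumes t: "Im \<tau> > 0"
  defines "a \<equiv> theta_zeta \<tau> (1 / 5)" and "b \<equiv> theta_zeta \<tau> (2 / 5)"
  defines "D \<equiv> theta_wp \<tau> (1 / 5) - theta_wp \<tau> (2 / 5)"
  shows "D = (a - 3 * b) * (3 * a + b)" "D \<noteq> 0"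
    "theta_wp' \<tau> (1 / 5) = - (3 * a + b) * D" "theta_wp' \<tau> (2 / 5) = - (a - 3 * b) * D"
    "theta_wp'' \<tau> (1 / 5) = 2 * theta_wp' \<tau> (1 / 5) * (b - 2 * a)"
    "theta \<tau> (2 / 5) ^ 5 / theta \<tau> (1 / 5) ^ 5 = (3 * a + b) / (a - 3 * b)"
proof -
  have s: "sin (pi * (1 / 5)) \<noteq> 0" "sin (pi * (2 / 5)) \<noteq> 0"
    by (rule less_imp_neq[THEN not_sym], rule sin_gt_zero; simp)+
  have nz: "theta \<tau> (1 / 5) \<noteq> 0" "theta \<tau> (2 / 5) \<noteq> 0"
    using theta_nonzero[OF t s(1)] theta_nonzero[OF t s(2)] by simp_all
  \<comment> \<open>Parity and translation by 1 bring all points back to \<open>1/5\<close> and \<open>2/5\<close>.\<close>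
  have e: "1 / 5 + 2 / 5 = - (2 / 5) + (1 :: complex)" "1 / 5 - 2 / 5 = - (1 / 5 :: complex)" 
     "2 / 5 + 1 / 5 = - (2 / 5) + (1 :: complex)" "2 / 5 - 1 / 5 = (1 / 5 :: complex)"
     "2 * (1 / 5) = (2 / 5 :: complex)" "2 * (2 / 5) = - (1 / 5) + (1 :: complex)" by simp_all
  have v: "theta \<tau> (- (2 / 5) + 1) = theta \<tau> (2 / 5)" "theta \<tau> (- (1 / 5) + 1) = theta \<tau> (1 / 5)"
    "theta \<tau> (- (1 / 5)) = - theta \<tau> (1 / 5)"
    "theta_zeta \<tau> (- (2 / 5) + 1) = - b" "theta_zeta \<tau> (- (1 / 5)) = - a"
    "theta_wp \<tau> (- (2 / 5) + 1) = theta_wp \<tau> (2 / 5)" "theta_wp \<tau> (- (1 / 5)) = theta_wp \<tau> (1 / 5)"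
    unfolding theta_parity_period a_def b_def by simp_all
  have "theta_wp' \<tau> (1 / 5) = D * (- b + - a - 2 * a)"
    using theta_wp'_eq[OF t nz(1,2)] nz unfolding e v by (simp add: D_def a_def)
  then show w1: "theta_wp' \<tau> (1 / 5) = - (3 * a + b) * D" by (simp add: algebra_simps)
  have "theta_wp' \<tau> (2 / 5) = - D * (- b + a - 2 * b)"
    using theta_wp'_eq[OF t nz(2,1)] nz unfolding e v by (simp add: D_def a_def b_def)
  then show w2: "theta_wp' \<tau> (2 / 5) = - (a - 3 * b) * D" by (simp add: algebra_simps)
  \<comment> \<open>The second expression for \<open>theta_wp' \<tau> (2 / 5)\<close>.\<close>
  have w3: "theta_wp' \<tau> (2 / 5) * (- b + - a - 2 * a) = D * D"
    using theta_wp'_other_eq[OF t nz(1,2)] nz unfolding e v by (simp add: D_def a_def)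
  have "(theta_deriv 1 \<tau> 0)\<^sup>2 * (theta \<tau> (2 / 5) * - theta \<tau> (1 / 5)) = - D * (theta \<tau> (1 / 5) * theta \<tau> (2 / 5))\<^sup>2"
    using theta_wp_diff[OF t nz(1,2)] unfolding e v by (simp add: D_def)
  then show D: "D \<noteq> 0" using nz theta_deriv_one_nonzero[OF t] by auto
  have "D * D = D * ((a - 3 * b) * (3 * a + b))" using w3 unfolding w2 by (simp add: algebra_simps)
  then show D_eq: "D = (a - 3 * b) * (3 * a + b)" using D by simp
  show "theta_wp'' \<tau> (1 / 5) = 2 * theta_wp' \<tau> (1 / 5) * (b - 2 * a)"
    using theta_wp''_eq[OF t nz(1)] nz unfolding e by (simp add: a_def b_def algebra_simps)
  define C where "C = - (theta_deriv 1 \<tau> 0 ^ 3)"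
  have C: "C \<noteq> 0" using theta_deriv_one_nonzero[OF t] by (simp add: C_def)
  have d: "theta_wp' \<tau> (1 / 5) * theta \<tau> (1 / 5) ^ 4 = C * theta \<tau> (2 / 5)"
     "theta_wp' \<tau> (2 / 5) * theta \<tau> (2 / 5) ^ 4 = C * theta \<tau> (1 / 5)"
    using theta_duplication[OF t nz(1)] theta_duplication[OF t nz(2)] unfolding e v C_def .
  define x where "x = theta \<tau> (1 / 5)"
  define y where "y = theta \<tau> (2 / 5)"
  have nz': "a - 3 * b \<noteq> 0" "3 * a + b \<noteq> 0" "x \<noteq> 0" "y \<noteq> 0" using D nz unfolding D_eq x_def y_def by auto
  have "(- (3 * a + b) * D * x ^ 4) * (C * x) = C * y * (- (a - 3 * b) * D * y ^ 4)"
    using d unfolding w1 w2 x_def y_def by simp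
  then have "(C * D) * ((3 * a + b) * x ^ 5) = (C * D) * ((a - 3 * b) * y ^ 5)"
    by (simp add: algebra_simps eval_nat_numeral)
  then have "(3 * a + b) * x ^ 5 = (a - 3 * b) * y ^ 5" using C D by simp
  then show "theta \<tau> (2 / 5) ^ 5 / theta \<tau> (1 / 5) ^ 5 = (3 * a + b) / (a - 3 * b)"
    unfolding x_def[symmetric] y_def[symmetric] using nz' by (simp add: divide_simps mult_ac)
qed

text \<open>
  The heat equation expresses the derivatives through \<open>\<wp>'\<close> and \<open>\<wp>''\<close> at the points of order five, and these are
  polynomials in \<open>a\<close>, \<open>b\<close> and \<open>p\<close>. This is the analogue for level five of Ramanujan's system, \<open>p\<close> playing the
  part of the quasimodular Eisenstein series of weight two.
\<close>

lemma fifth_torsion_system: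
  assumes t: "Im \<tau> > 0"
  defines "a \<equiv> \<lambda>\<tau>. theta_zeta \<tau> (1 / 5)" and "b \<equiv> \<lambda>\<tau>. theta_zeta \<tau> (2 / 5)" and "p \<equiv> \<lambda>\<tau>. theta_wp \<tau> (1 / 5)"
  defines "D \<equiv> (a \<tau> - 3 * b \<tau>) * (3 * a \<tau> + b \<tau>)"
  shows "(a has_field_derivative ((3 * a \<tau> + b \<tau>) * D - 2 * a \<tau> * p \<tau>) / (4 * of_real pi * \<i>)) (at \<tau>)"
    "(b has_field_derivative ((a \<tau> - b \<tau>) * D - 2 * b \<tau> * p \<tau>) / (4 * of_real pi * \<i>)) (at \<tau>)"
    "(p has_field_derivative (2 * (3 * a \<tau> + b \<tau>) * (a \<tau> - b \<tau>) * D - 2 * (p \<tau>)\<^sup>2) / (4 * of_real pi * \<i>)) (at \<tau>)"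
proof -
  have s: "sin (pi * (1 / 5)) \<noteq> 0" "sin (pi * (2 / 5)) \<noteq> 0"
    by (rule less_imp_neq[THEN not_sym], rule sin_gt_zero; simp)+
  have nz: "theta \<tau> (1 / 5) \<noteq> 0" "theta \<tau> (2 / 5) \<noteq> 0"
    using theta_nonzero[OF t s(1)] theta_nonzero[OF t s(2)] by simp_all
  have D: "theta_wp \<tau> (1 / 5) - theta_wp \<tau> (2 / 5) = D"
    unfolding D_def a_def b_def by (rule fifth_torsion_relations(1)[OF t])
  then have p2: "theta_wp \<tau> (2 / 5) = p \<tau> - D" by (simp add: p_def algebra_simps)
  note r = fifth_torsion_relations(3-5)[OF t, unfolded D]
  show "(a has_field_derivative ((3 * a \<tau> + b \<tau>) * D - 2 * a \<tau> * p \<tau>) / (4 * of_real pi * \<i>)) (at \<tau>)"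
    unfolding a_def
    by (rule DERIV_cong[OF theta_zeta_tau_deriv[OF t nz(1)]]) (simp add: r p_def b_def algebra_simps)
  show "(b has_field_derivative ((a \<tau> - b \<tau>) * D - 2 * b \<tau> * p \<tau>) / (4 * of_real pi * \<i>)) (at \<tau>)"
    unfolding b_def
    by (rule DERIV_cong[OF theta_zeta_tau_deriv[OF t nz(2)]]) (simp add: r p2 a_def algebra_simps)
  show "(p has_field_derivative (2 * (3 * a \<tau> + b \<tau>) * (a \<tau> - b \<tau>) * D - 2 * (p \<tau>)\<^sup>2) / (4 * of_real pi * \<i>)) (at \<tau>)"
    unfolding p_def
    by (rule DERIV_cong[OF theta_wp_tau_deriv[OF t nz(1)]]) (simp add: r a_def b_def algebra_simps)
qed

section \<open>The differential system and its Schwarzian\<close>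

text \<open>
  A solution of a homogeneous linear equation is a constant multiple of a nowhere vanishing exponential.
\<close>

lemma linear_ode_zero:
  fixes A g :: "complex \<Rightarrow> complex"
  assumes S: "open S" "convex S" and g: "g holomorphic_on S"
    and A: "\<And>x. x \<in> S \<Longrightarrow> (A has_field_derivative g x * A x) (at x)"
    and z: "z \<in> S" "A z = 0" and x: "x \<in> S"
  shows "A x = 0"
proof -
  obtain G where G: "\<And>x. x \<in> S \<Longrightarrow> (G has_field_derivative g x) (at x within S)"
    by (rule holomorphic_convex_primitive'[OF S(2,1) g], rule that, blast)
  have "((\<lambda>x. A x * exp (- G x)) has_field_derivative 0) (at x within S)" if "x \<in> S" for x
    by (rule derivative_eq_intros G[OF that] A[OF that, THEN has_field_derivative_at_within] refl)+ simp
  then have "\<exists>c. \<forall>x\<in>S. A x * exp (- G x) = c"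
    by (rule has_field_derivative_zero_constant[OF S(2)])
  then obtain c where c: "\<And>x. x \<in> S \<Longrightarrow> A x * exp (- G x) = c" by auto
  have "A x * exp (- G x) = 0" using c[OF x] c[OF z(1)] z(2) by simp
  then show ?thesis by simp
qed

text \<open>
  For a solution of the system, \<open>f\<close> and \<open>A\<close> both have logarithmic derivatives that are polynomials in \<open>a\<close>, \<open>b\<close>, \<open>p\<close>.
  Hence so does \<open>deriv f\<close>; call its logarithmic derivative \<open>L / k\<close>. The Schwarzian is then
  \<open>(L' - L\<^sup>2 / 2) / k\<^sup>2\<close>, where \<open>L' / k\<close> is the derivative of \<open>L\<close>. In it all terms with \<open>p\<close> cancel, and what is left is a
  binary quartic in \<open>u = 3 a + b\<close> and \<open>v = a - 3 b\<close>, the numerator and the denominator of \<open>f\<close>.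
\<close>

lemma schwarzian_of_system:
  fixes a b p f :: "complex \<Rightarrow> complex"
  assumes S: "open S" and k: "k \<noteq> 0"
    and a: "\<And>x. x \<in> S \<Longrightarrow> (a has_field_derivative ((3 * a x + b x) * D x - 2 * a x * p x) / k) (at x)"
    and b: "\<And>x. x \<in> S \<Longrightarrow> (b has_field_derivative ((a x - b x) * D x - 2 * b x * p x) / k) (at x)"
    and p: "\<And>x. x \<in> S \<Longrightarrow> (p has_field_derivative (2 * (3 * a x + b x) * (a x - b x) * D x - 2 * (p x)\<^sup>2) / k) (at x)"
    and D: "\<And>x. D x = (a x - 3 * b x) * (3 * a x + b x)" and D0: "\<And>x. x \<in> S \<Longrightarrow> D x \<noteq> 0"
    and A: "\<And>x. A x = (a x)\<^sup>2 - 4 * a x * b x - (b x)\<^sup>2"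
    and f: "\<And>x. x \<in> S \<Longrightarrow> f x = (3 * a x + b x) / (a x - 3 * b x)"
    and z: "z \<in> S"
  shows "(f has_field_derivative 10 * f z * A z / k) (at z)"
    "(A has_field_derivative 2 * A z * (D z - 2 * p z) / k) (at z)"
    "f z ^ 2 - 11 * f z - 1 = - 25 * A z / (a z - 3 * b z) ^ 2"
    "A z \<noteq> 0 \<Longrightarrow> schwarzian f z
        + (f z ^ 4 - 12 * f z ^ 3 + 134 * f z ^ 2 + 12 * f z + 1)
            / (2 * f z ^ 2 * (f z ^ 2 - 11 * f z - 1) ^ 2) * (deriv f z) ^ 2 = 0"
proof -
  have nz: "a x - 3 * b x \<noteq> 0" "3 * a x + b x \<noteq> 0" if "x \<in> S" for x using D0[OF that] D[of x] by auto
  have df: "(f has_field_derivative 10 * f x * A x / k) (at x)" if x: "x \<in> S" for x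
  proof -
    define u where "u = 3 * a x + b x"
    define v where "v = a x - 3 * b x"
    define Na where "Na = u * D x - 2 * a x * p x"
    define Nb where "Nb = (a x - b x) * D x - 2 * b x * p x"
    have uv: "v \<noteq> 0" using nz[OF x] by (simp add: v_def)
    have da: "(a has_field_derivative Na / k) (at x)" and db: "(b has_field_derivative Nb / k) (at x)"
      using a[OF x] b[OF x] by (simp_all add: Na_def Nb_def u_def)
    have "((\<lambda>x. (3 * a x + b x) / (a x - 3 * b x)) has_field_derivative 
        ((3 * (Na / k) + Nb / k) * v - u * (Na / k - 3 * (Nb / k))) / (v * v)) (at x)"
      unfolding u_def v_def
      by (rule DERIV_divide derivative_intros da db DERIV_cmult nz(1)[OF x])+
    also have "(3 * (Na / k) + Nb / k) * v - u * (Na / k - 3 * (Nb / k)) = 10 * (a x * Nb - b x * Na) / k"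
      by (simp add: u_def v_def algebra_simps add_divide_distrib diff_divide_distrib)
    also have "a x * Nb - b x * Na = (u * v) * A x"
      by (simp add: Na_def Nb_def A D u_def v_def algebra_simps power2_eq_square)
    also have "10 * (u * v * A x) / k / (v * v) = 10 * f x * A x / k"
    proof -
      have "f x = u / v" by (simp add: f[OF x] u_def v_def)
      then show ?thesis using uv by (simp add: mult_ac)
    qed
    finally have "((\<lambda>x. (3 * a x + b x) / (a x - 3 * b x)) has_field_derivative 10 * f x * A x / k) (at x)" .
    then show ?thesis
      by (rule has_field_derivative_transform_within_open[OF _ S x]) (simp add: f)
  qed
  have dA: "(A has_field_derivative 2 * A x * (D x - 2 * p x) / k) (at x)" if x: "x \<in> S" for x
    unfolding A[abs_def]
    by (rule a[OF x] b[OF x] derivative_eq_intros refl)+ 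
       (simp add: D add_divide_distrib diff_divide_distrib algebra_simps power2_eq_square)
  show "(f has_field_derivative 10 * f z * A z / k) (at z)" by (rule df[OF z])
  show "(A has_field_derivative 2 * A z * (D z - 2 * p z) / k) (at z)" by (rule dA[OF z])
  show f11: "f z ^ 2 - 11 * f z - 1 = - 25 * A z / (a z - 3 * b z) ^ 2"
    using nz[OF z] by (simp add: f[OF z] A divide_simps) (simp add: algebra_simps power2_eq_square)
  define L where "L x = 10 * A x + 2 * D x - 4 * p x" for x
  define L' where "L' x = 20 * A x * (D x - 2 * p x) + 2 * (((3 * (3 * a x + b x) + a x - b x) * D x - 2 * (3 * a x + b x) * p x) * (a x - 3 * b x)
      + (3 * a x + b x) * (4 * b x * D x - 2 * (a x - 3 * b x) * p x)) - 4 * (2 * (3 * a x + b x) * (a x - b x) * D x - 2 * (p x)\<^sup>2)" for x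
  have dD: "(D has_field_derivative (((3 * (3 * a x + b x) + a x - b x) * D x - 2 * (3 * a x + b x) * p x) * (a x - 3 * b x)
      + (3 * a x + b x) * (4 * b x * D x - 2 * (a x - 3 * b x) * p x)) / k) (at x)" if x: "x \<in> S" for x
    unfolding D[abs_def]
    by (rule a[OF x] b[OF x] derivative_eq_intros refl)+ 
       (simp add: D add_divide_distrib diff_divide_distrib algebra_simps)
  have dL: "(L has_field_derivative L' x / k) (at x)" if x: "x \<in> S" for x
    unfolding L_def[abs_def]
    by (rule dA[OF x] dD[OF x] p[OF x] derivative_eq_intros refl)+ 
       (simp add: L'_def add_divide_distrib diff_divide_distrib algebra_simps)
  have 1: "deriv f x = 10 * f x * A x / k" if "x \<in> S" for x using df[OF that] by (rule DERIV_imp_deriv)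
  have d1: "((\<lambda>x. 10 * f x * A x / k) has_field_derivative (10 * f x * A x / k) * L x / k) (at x)" if x: "x \<in> S" for x
    by (rule df[OF x] dA[OF x] derivative_eq_intros refl)+ (use k in \<open>simp_all add: L_def field_simps\<close>)
  have "(deriv f has_field_derivative (10 * f x * A x / k) * L x / k) (at x)" if x: "x \<in> S" for x
    using d1[OF x] by (rule has_field_derivative_transform_within_open[OF _ S x]) (simp add: 1)
  then have 2: "(deriv ^^ 2) f x = (10 * f x * A x / k) * L x / k" if "x \<in> S" for x
    using that by (simp add: numeral_2_eq_2 DERIV_imp_deriv)
  have "((deriv ^^ 2) f has_field_derivative (10 * f z * A z / k) * ((L z)\<^sup>2 + L' z) / k\<^sup>2) (at z)"
  proof -
    have "((\<lambda>x. (10 * f x * A x / k) * L x / k) has_field_derivative (10 * f z * A z / k) * ((L z)\<^sup>2 + L' z) / k\<^sup>2) (at z)"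
      by (rule DERIV_cong[OF DERIV_cdivide[OF DERIV_mult'[OF d1[OF z] dL[OF z]]]])
         (use k in \<open>simp add: field_simps power2_eq_square\<close>)
    then show ?thesis
      by (rule has_field_derivative_transform_within_open[OF _ S z]) (simp add: 2)
  qed
  then have 3: "(deriv ^^ 3) f z = (10 * f z * A z / k) * ((L z)\<^sup>2 + L' z) / k\<^sup>2"
    by (simp add: numeral_3_eq_3 numeral_2_eq_2 DERIV_imp_deriv)
  show "schwarzian f z
        + (f z ^ 4 - 12 * f z ^ 3 + 134 * f z ^ 2 + 12 * f z + 1)
            / (2 * f z ^ 2 * (f z ^ 2 - 11 * f z - 1) ^ 2) * (deriv f z) ^ 2 = 0" if A0: "A z \<noteq> 0"
  proof -
    define u where "u = 3 * a z + b z"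
    define v where "v = a z - 3 * b z"
    have fz: "f z = u / v" by (simp add: f[OF z] u_def v_def)
    have uv: "u \<noteq> 0" "v \<noteq> 0" using nz[OF z] by (auto simp: u_def v_def)
    define F where "F = 10 * f z * A z / k"
    have F: "F \<noteq> 0" using A0 k uv by (simp add: F_def fz)
    have "schwarzian f z = (F * ((L z)\<^sup>2 + L' z) / k\<^sup>2) / F - 3 / 2 * ((F * L z / k) / F)\<^sup>2"
      unfolding schwarzian_def 3 2[OF z] 1[OF z] F_def ..
    also have "\<dots> = (L' z - (L z)\<^sup>2 / 2) / k\<^sup>2"
      using F k by (simp add: field_simps power2_eq_square)
    also have "L' z - (L z)\<^sup>2 / 2 = - (2 / 25) * (u ^ 4 - 12 * u ^ 3 * v + 134 * u\<^sup>2 * v\<^sup>2 + 12 * u * v ^ 3 + v ^ 4)"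
      unfolding L'_def L_def A D u_def v_def by (simp add: field_simps power2_eq_square power3_eq_cube power4_eq_xxxx)
    finally have s: "schwarzian f z = 
       - (2 / 25) * (u ^ 4 - 12 * u ^ 3 * v + 134 * u\<^sup>2 * v\<^sup>2 + 12 * u * v ^ 3 + v ^ 4) / k\<^sup>2" .
    have n: "f z ^ 4 - 12 * f z ^ 3 + 134 * f z ^ 2 + 12 * f z + 1 = 
        (u ^ 4 - 12 * u ^ 3 * v + 134 * u\<^sup>2 * v\<^sup>2 + 12 * u * v ^ 3 + v ^ 4) / v ^ 4"
      using uv unfolding fz by (simp add: field_simps eval_nat_numeral)
    have "(f z ^ 4 - 12 * f z ^ 3 + 134 * f z ^ 2 + 12 * f z + 1)
            / (2 * f z ^ 2 * (f z ^ 2 - 11 * f z - 1) ^ 2) * (deriv f z) ^ 2 = 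
         (2 / 25) * (u ^ 4 - 12 * u ^ 3 * v + 134 * u\<^sup>2 * v\<^sup>2 + 12 * u * v ^ 3 + v ^ 4) / k\<^sup>2"
      unfolding n f11 1[OF z] v_def[symmetric] unfolding fz
      using uv k A0 by (simp add: divide_simps)
    then show ?thesis unfolding s by simp
  qed
qed

section \<open>The theta quotient\<close>

text \<open>
  The angle \<open>t\<close> of a fifth of a turn satisfies \<open>cos (3 * t) = cos (2 * t)\<close>, a cubic equation for \<open>cos t\<close> whose root
  \<open>1\<close> is discarded.
\<close>

lemma cos_fifth_turn:
  "2 * cos (2 * pi * (1 / 5)) = - ((1 - sqrt 5) / 2)" "2 * cos (2 * pi * (2 / 5)) = - ((1 + sqrt 5) / 2)"
  "sin (pi * (2 / 5)) = (1 + sqrt 5) / 2 * sin (pi * (1 / 5))"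
proof -
  define t where "t = 2 * pi / 5"
  define c where "c = cos t"
  have c0: "c > 0" unfolding c_def t_def by (rule cos_gt_zero) auto
  have c1: "c \<noteq> 1"
  proof
    assume "c = 1"
    moreover have "cos t < cos 0" by (rule cos_monotone_0_pi) (auto simp: t_def)
    ultimately show False by (simp add: c_def)
  qed
  have "cos (3 * t) = cos (2 * pi - 2 * t)" by (simp add: t_def field_simps)
  then have "cos (2 * t + t) = cos (2 * t)" by (simp add: cos_diff)
  moreover have "cos (y + t) + cos (y - t) = 2 * cos y * cos t" for y by (simp add: cos_add cos_diff)
  from this[of "2 * t"] have "cos (2 * t + t) + cos t = 2 * cos (2 * t) * cos t" by simp
  moreover have c2: "cos (2 * t) = 2 * c\<^sup>2 - 1" by (simp add: c_def cos_double_cos)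
  ultimately have "(2 * c\<^sup>2 - 1) + c = 2 * (2 * c\<^sup>2 - 1) * c" by (simp add: c_def)
  then have "(c - 1) * ((4 * c + 1)\<^sup>2 - 5) = 0" by (simp add: algebra_simps power2_eq_square)
  then have "(4 * c + 1)\<^sup>2 = 5" using c1 by simp
  then have "4 * c + 1 = sqrt 5" using c0 by (intro real_sqrt_unique[symmetric]) auto
  then have c: "c = (sqrt 5 - 1) / 4" by simp
  show "2 * cos (2 * pi * (1 / 5)) = - ((1 - sqrt 5) / 2)" using c by (simp add: c_def t_def field_simps)
  have c2': "cos (2 * t) = - ((1 + sqrt 5) / 4)"
    unfolding c2 c by (simp add: power2_eq_square field_simps)
  have "2 * pi * (2 / 5) = 2 * t" by (simp add: t_def)
  then show "2 * cos (2 * pi * (2 / 5)) = - ((1 + sqrt 5) / 2)" using c2' by (simp only:)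
  have "cos (pi * (1 / 5)) = cos (pi - 2 * t)" by (simp add: t_def field_simps)
  also have "\<dots> = - cos (2 * t)" by (simp add: cos_diff)
  also have "\<dots> = (1 + sqrt 5) / 4" unfolding c2' by (rule minus_minus)
  finally have "cos (pi * (1 / 5)) = (1 + sqrt 5) / 4" .
  moreover have "sin (pi * (2 / 5)) = 2 * sin (pi * (1 / 5)) * cos (pi * (1 / 5))"
    using sin_double[of "pi * (1 / 5)"] by (simp add: mult.commute[of pi 2])
  ultimately show "sin (pi * (2 / 5)) = (1 + sqrt 5) / 2 * sin (pi * (1 / 5))" by simp
qed

lemma theta_char_eq_theta:
  "theta_char 1 e 0 \<tau> = \<i> * theta \<tau> ((of_real e - 1) / 2)"
proof -
  have "exp (2 * of_real pi * \<i> * (1 / 2 * (of_int n + of_real 1 / 2)\<^sup>2 * \<tau> + (of_int n + of_real 1 / 2) * (0 + of_real e / 2)))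
     = \<i> * theta_term \<tau> ((of_real e - 1) / 2) n" for n
  proof -
    have h1: "exp (- (of_real pi * \<i> * of_int n)) = (if even n then 1 else - 1)"
    proof (cases "even n")
      case True
      then obtain m where "n = 2 * m" by (elim evenE)
      then show ?thesis using exp_integer_2pi[of "of_int (- m)"] by (simp add: mult_ac)
    next
      case False
      then obtain m where "n = 2 * m + 1" by (elim oddE)
      then show ?thesis using exp_integer_2pi[of "of_int (- m)"] by (simp add: algebra_simps exp_diff exp_add exp_minus)
    qed
    have h2: "exp (- (of_real pi * \<i> / 2)) = - \<i>"
    proof -
      have "- (of_real pi * \<i> / 2) = \<i> * of_real (- (pi / 2))" by simp
      then have "exp (- (of_real pi * \<i> / 2)) = cis (- (pi / 2))" by (simp only: cis_conv_exp)
      also have "cis (- (pi / 2)) = - \<i>" by (simp add: complex_eq_iff)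
      finally show ?thesis .
    qed
    have h3: "of_real pi * \<i> * ((of_int (2 * n + 1))\<^sup>2 / 4 * \<tau> + of_int (2 * n + 1) * ((of_real e - 1) / 2)) =
       2 * of_real pi * \<i> * (1 / 2 * (of_int n + of_real 1 / 2)\<^sup>2 * \<tau> + (of_int n + of_real 1 / 2) * (0 + of_real e / 2))
       + (- (of_real pi * \<i> * of_int n)) + (- (of_real pi * \<i> / 2))"
      by (simp add: field_simps power2_eq_square)
    show ?thesis unfolding theta_term_def h3 exp_add h1 h2 by (simp add: mult.commute[of _ \<i>])
  qed
  then show ?thesis unfolding theta_char_def theta_deriv_def by (simp add: infsum_cmult_right')
qed

lemma theta_char_ratio:
  "theta_char 1 (1 / 5) 0 \<tau> ^ 5 / theta_char 1 (3 / 5) 0 \<tau> ^ 5 = theta \<tau> (2 / 5) ^ 5 / theta \<tau> (1 / 5) ^ 5"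
proof -
  have "(complex_of_real (1 / 5) - 1) / 2 = - (2 / 5)" "(complex_of_real (3 / 5) - 1) / 2 = - (1 / 5)" by simp_all
  then show ?thesis unfolding theta_char_eq_theta by (simp add: theta_parity_period(1) power_mult_distrib)
qed

text \<open>
  The triple products at \<open>2/5\<close> and \<open>1/5\<close>. The prefactor is the fifth power of the quotient
  \<open>sin (2 * pi / 5) / sin (pi / 5)\<close>, which is the golden ratio.
\<close>

lemma theta_ratio_product:
  assumes t: "Im \<tau> > 0"
  defines "q \<equiv> exp (2 * of_real pi * \<i> * \<tau>)"
  defines "P \<equiv> \<lambda>n. (1 + of_real ((1 + sqrt 5) / 2) * q ^ n + q ^ (2 * n)) ^ 5
                   / (1 + of_real ((1 - sqrt 5) / 2) * q ^ n + q ^ (2 * n)) ^ 5"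
  shows "convergent_prod (\<lambda>n. P (Suc n))"
    "theta \<tau> (2 / 5) ^ 5 / theta \<tau> (1 / 5) ^ 5 = of_real ((11 + 5 * sqrt 5) / 2) * (\<Prod>n. P (Suc n))"
proof -
  have q: "norm q < 1" unfolding q_def by (rule norm_nome[OF t])
  define N where "N w k = 1 - w * q ^ Suc k + q ^ (2 * Suc k)" for w k
  have c: "convergent_prod (N w)" for w unfolding N_def by (rule convergent_prod_one_plus_powers[OF q])
  let ?w1 = "complex_of_real (2 * cos (2 * pi * (1 / 5)))" and ?w2 = "complex_of_real (2 * cos (2 * pi * (2 / 5)))"
  have P: "P (Suc n) = N ?w2 n ^ 5 / N ?w1 n ^ 5" for n
    unfolding P_def N_def cos_fifth_turn by simp
  show cP: "convergent_prod (\<lambda>n. P (Suc n))"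
    unfolding P by (intro convergent_prod_divide convergent_prod_power c)
  have prod: "(\<Prod>n. P (Suc n)) = prodinf (N ?w2) ^ 5 / prodinf (N ?w1) ^ 5"
    unfolding P by (simp only: prodinf_divide[symmetric] prodinf_power convergent_prod_power c)
  obtain K where K: "K \<noteq> 0" "\<And>x::real. theta \<tau> (of_real x) = K * of_real (sin (pi * x)) * prodinf (N (of_real (2 * cos (2 * pi * x))))"
    by (rule theta_product[OF t]) (simp only: N_def[abs_def] q_def)
  have s: "sin (pi * (1 / 5)) \<noteq> 0" using sin_gt_zero[of "pi * (1 / 5)"] by simp
  have "theta \<tau> (2 / 5) = K * of_real ((1 + sqrt 5) / 2 * sin (pi * (1 / 5))) * prodinf (N ?w2)"
    using K(2)[of "2 / 5"] unfolding cos_fifth_turn(3) by simp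
  moreover have "theta \<tau> (1 / 5) = K * of_real (sin (pi * (1 / 5))) * prodinf (N ?w1)"
    using K(2)[of "1 / 5"] by simp
  ultimately have "theta \<tau> (2 / 5) ^ 5 / theta \<tau> (1 / 5) ^ 5 = of_real (((1 + sqrt 5) / 2) ^ 5) * (prodinf (N ?w2) ^ 5 / prodinf (N ?w1) ^ 5)"
  proof -
    have "(K * (G * C) * Y) ^ 5 / (K * C * X) ^ 5 = G ^ 5 * (Y ^ 5 / X ^ 5)" if "C \<noteq> 0" for G C X Y :: complex
      using K(1) that by (simp add: power_mult_distrib)
    from this[of "of_real (sin (pi * (1 / 5)))"] show ?thesis
      using s \<open>theta \<tau> (2 / 5) = _\<close> \<open>theta \<tau> (1 / 5) = _\<close> unfolding of_real_mult[symmetric] of_real_power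
      by (simp only: of_real_eq_0_iff not_False_eq_True of_real_mult simp_thms)
  qed
  also have "((1 + sqrt 5) / 2) ^ 5 = (11 + 5 * sqrt 5) / 2"
  proof -
    have "((1 + sqrt 5) / 2) ^ 2 = (3 + sqrt 5) / 2" by (simp add: power2_eq_square field_simps)
    moreover have "((3 + sqrt 5) / 2) ^ 2 = (7 + 3 * sqrt 5) / 2" by (simp add: power2_eq_square field_simps)
    moreover have "x ^ 5 = (x ^ 2) ^ 2 * x" for x :: real by (simp add: eval_nat_numeral)
    ultimately have "((1 + sqrt 5) / 2) ^ 5 = (7 + 3 * sqrt 5) / 2 * ((1 + sqrt 5) / 2)" by metis
    then show ?thesis by (simp add: field_simps)
  qed
  finally show "theta \<tau> (2 / 5) ^ 5 / theta \<tau> (1 / 5) ^ 5 = of_real ((11 + 5 * sqrt 5) / 2) * (\<Prod>n. P (Suc n))"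
    unfolding prod .
qed

text \<open>
  For \<open>\<tau> = \<i>\<close> the nome is real and lies between \<open>0\<close> and \<open>1\<close>, so every factor of the product exceeds \<open>1\<close>. This
  separates the quotient from \<open>(11 + 5 * sqrt 5) / 2\<close>, the larger root of \<open>X\<^sup>2 - 11 * X - 1\<close>.
\<close>

lemma theta_ratio_at_i:
  obtains x :: real where "x > (11 + 5 * sqrt 5) / 2" "theta \<i> (2 / 5) ^ 5 / theta \<i> (1 / 5) ^ 5 = of_real x"
proof -
  define r where "r = exp (- (2 * pi))"
  define R where "R n = (1 + (1 + sqrt 5) / 2 * r ^ n + r ^ (2 * n)) ^ 5 / (1 + (1 - sqrt 5) / 2 * r ^ n + r ^ (2 * n)) ^ 5" for n
  have t: "Im \<i> > 0" by simp
  have q: "exp (2 * of_real pi * \<i> * \<i>) = complex_of_real r"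
    by (simp add: r_def exp_of_real[symmetric] mult.assoc)
  note pr = theta_ratio_product[OF t, unfolded q]
  have P: "(1 + complex_of_real ((1 + sqrt 5) / 2) * of_real r ^ n + of_real r ^ (2 * n)) ^ 5
      / (1 + of_real ((1 - sqrt 5) / 2) * of_real r ^ n + of_real r ^ (2 * n)) ^ 5 = of_real (R n)" for n
    by (simp add: R_def)
  have cR: "convergent_prod (\<lambda>n. R (Suc n))"
    using pr(1) unfolding P using convergent_prod_of_real_iff[of "\<lambda>n. R (Suc n)"] by (simp add: o_def)
  have gt: "R n > 1" if "n > 0" for n
  proof -
    define y where "y = r ^ n"
    have r: "0 < r" "r < 1" by (simp_all add: r_def)
    have y: "0 < y" "y < 1" using r that by (auto simp: y_def power_less_one_iff)
    have s5: "sqrt 5 < 3" by (rule real_less_lsqrt) auto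
    have s0: "sqrt 5 > 0" by simp
    have "(sqrt 5 - 1) / 2 * y \<le> 1 * 1" using y s5 by (intro mult_mono) auto
    moreover have "1 + (1 - sqrt 5) / 2 * y + y\<^sup>2 = 1 - (sqrt 5 - 1) / 2 * y + y\<^sup>2" by (simp add: field_simps)
    ultimately have den: "1 + (1 - sqrt 5) / 2 * y + y\<^sup>2 > 0" using zero_less_power[OF y(1), of 2] by linarith
    have "1 + (1 - sqrt 5) / 2 * y + y\<^sup>2 < 1 + (1 + sqrt 5) / 2 * y + y\<^sup>2"
      using mult_pos_pos[OF s0 y(1)] by (simp add: algebra_simps)
    then have "(1 + (1 - sqrt 5) / 2 * y + y\<^sup>2) ^ 5 < (1 + (1 + sqrt 5) / 2 * y + y\<^sup>2) ^ 5"
      using den by (intro power_strict_mono) auto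
    moreover have "(1 + (1 - sqrt 5) / 2 * y + y\<^sup>2) ^ 5 > 0" using den by (rule zero_less_power)
    moreover have "r ^ (2 * n) = y\<^sup>2" by (simp add: y_def power_mult[symmetric] mult.commute)
    ultimately show ?thesis by (simp add: R_def y_def[symmetric])
  qed
  have "prodinf (\<lambda>n. R (Suc n)) > 1" by (rule less_1_prodinf[OF cR]) (simp add: gt)
  moreover have "(11 + 5 * sqrt 5) / 2 > 0" by (simp add: add_pos_pos)
  ultimately have x: "(11 + 5 * sqrt 5) / 2 < (11 + 5 * sqrt 5) / 2 * prodinf (\<lambda>n. R (Suc n))" 
    by (metis mult.right_neutral mult_strict_left_mono)
  have "(\<lambda>n. \<Prod>k\<le>n. complex_of_real (R (Suc k))) \<longlonglongrightarrow> of_real (prodinf (\<lambda>n. R (Suc n)))"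
    using tendsto_of_real[where 'a = complex, OF convergent_prod_LIMSEQ[OF cR]] by simp
  moreover have "(\<lambda>n. \<Prod>k\<le>n. complex_of_real (R (Suc k))) \<longlonglongrightarrow> (\<Prod>n. complex_of_real (R (Suc n)))"
    using pr(1) unfolding P by (rule convergent_prod_LIMSEQ)
  ultimately have "(\<Prod>n. complex_of_real (R (Suc n))) = of_real (prodinf (\<lambda>n. R (Suc n)))"
    using LIMSEQ_unique by blast
  then have "theta \<i> (2 / 5) ^ 5 / theta \<i> (1 / 5) ^ 5 = of_real ((11 + 5 * sqrt 5) / 2 * prodinf (\<lambda>n. R (Suc n)))"
    using pr(2) unfolding P by simp
  then show ?thesis using that x by blast
qed

theorem theorem6p1:
  fixes f :: "complex \<Rightarrow> complex"
  assumes f: "\<And>\<tau>. \<tau> \<in> upper_half_plane \<Longrightarrow>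
      f \<tau> = theta_char 1 (1 / 5) 0 \<tau> ^ 5 / theta_char 1 (3 / 5) 0 \<tau> ^ 5"
  shows "f holomorphic_on upper_half_plane \<and>
    (\<forall>\<tau>\<in>upper_half_plane.
      theta_char 1 (3 / 5) 0 \<tau> \<noteq> 0 \<and>
      f \<tau> \<noteq> 0 \<and> f \<tau> ^ 2 - 11 * f \<tau> - 1 \<noteq> 0 \<and> deriv f \<tau> \<noteq> 0 \<and>
      (let q = exp (2 * of_real pi * \<i> * \<tau>);
           P = (\<lambda>n. (1 + of_real ((1 + sqrt 5) / 2) * q ^ n + q ^ (2 * n)) ^ 5
                   / (1 + of_real ((1 - sqrt 5) / 2) * q ^ n + q ^ (2 * n)) ^ 5)
       in convergent_prod (\<lambda>n. P (Suc n)) \<and>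
          f \<tau> = of_real ((11 + 5 * sqrt 5) / 2) * (\<Prod>n. P (Suc n))) \<and>
      schwarzian f \<tau>
        + (f \<tau> ^ 4 - 12 * f \<tau> ^ 3 + 134 * f \<tau> ^ 2 + 12 * f \<tau> + 1)
            / (2 * f \<tau> ^ 2 * (f \<tau> ^ 2 - 11 * f \<tau> - 1) ^ 2) * (deriv f \<tau>) ^ 2 = 0)"
proof -
  define k where "k = 4 * of_real pi * \<i>"
  have k: "k \<noteq> 0" by (simp add: k_def)
  define a where "a \<tau> = theta_zeta \<tau> (1 / 5)" for \<tau>
  define b where "b \<tau> = theta_zeta \<tau> (2 / 5)" for \<tau>
  define p where "p \<tau> = theta_wp \<tau> (1 / 5)" for \<tau>
  define D where "D \<tau> = (a \<tau> - 3 * b \<tau>) * (3 * a \<tau> + b \<tau>)" for \<tau>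
  define A where "A \<tau> = (a \<tau>)\<^sup>2 - 4 * a \<tau> * b \<tau> - (b \<tau>)\<^sup>2" for \<tau>
  have im: "Im \<tau> > 0" if "\<tau> \<in> upper_half_plane" for \<tau> using that by (simp add: upper_half_plane_def)
  have S: "open upper_half_plane" "convex upper_half_plane"
    unfolding upper_half_plane_def by (simp_all add: open_halfspace_Im_gt convex_halfspace_Im_gt)
  have f': "f \<tau> = theta \<tau> (2 / 5) ^ 5 / theta \<tau> (1 / 5) ^ 5" if "\<tau> \<in> upper_half_plane" for \<tau>
    unfolding f[OF that] by (rule theta_char_ratio)
  have f_ab: "f \<tau> = (3 * a \<tau> + b \<tau>) / (a \<tau> - 3 * b \<tau>)" if "\<tau> \<in> upper_half_plane" for \<tau>
    unfolding f'[OF that] a_def b_def by (rule fifth_torsion_relations(6)[OF im[OF that]])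
  have D0: "D \<tau> \<noteq> 0" if "\<tau> \<in> upper_half_plane" for \<tau>
    using fifth_torsion_relations(1,2)[OF im[OF that]] unfolding D_def a_def b_def by simp
  have da: "(a has_field_derivative ((3 * a \<tau> + b \<tau>) * D \<tau> - 2 * a \<tau> * p \<tau>) / k) (at \<tau>)"
    and db: "(b has_field_derivative ((a \<tau> - b \<tau>) * D \<tau> - 2 * b \<tau> * p \<tau>) / k) (at \<tau>)"
    and dp: "(p has_field_derivative (2 * (3 * a \<tau> + b \<tau>) * (a \<tau> - b \<tau>) * D \<tau> - 2 * (p \<tau>)\<^sup>2) / k) (at \<tau>)"
    if "\<tau> \<in> upper_half_plane" for \<tau>
    using fifth_torsion_system[OF im[OF that]] unfolding a_def[abs_def] b_def[abs_def] p_def[abs_def] D_def k_def .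
  have df: "(f has_field_derivative 10 * f \<tau> * A \<tau> / k) (at \<tau>)"
    and dA: "(A has_field_derivative 2 * A \<tau> * (D \<tau> - 2 * p \<tau>) / k) (at \<tau>)"
    and f11: "f \<tau> ^ 2 - 11 * f \<tau> - 1 = - 25 * A \<tau> / (a \<tau> - 3 * b \<tau>) ^ 2"
    and schw: "A \<tau> \<noteq> 0 \<Longrightarrow> schwarzian f \<tau>
        + (f \<tau> ^ 4 - 12 * f \<tau> ^ 3 + 134 * f \<tau> ^ 2 + 12 * f \<tau> + 1)
            / (2 * f \<tau> ^ 2 * (f \<tau> ^ 2 - 11 * f \<tau> - 1) ^ 2) * (deriv f \<tau>) ^ 2 = 0"
    if "\<tau> \<in> upper_half_plane" for \<tau>
    by (rule schwarzian_of_system[OF S(1) k da db dp D_def D0 A_def f_ab that]; assumption)+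
  have A0: "A \<tau> \<noteq> 0" if \<tau>: "\<tau> \<in> upper_half_plane" for \<tau>
  proof
    \<comment> \<open>A zero of \<open>A\<close> propagates to the whole half plane, in particular to \<open>\<i>\<close>. There \<open>f\<close> would be
      a root of \<open>X\<^sup>2 - 11 * X - 1\<close>, but it is real and larger than both roots.\<close>
    assume z: "A \<tau> = 0"
    have i: "\<i> \<in> upper_half_plane" by (simp add: upper_half_plane_def)
    have "A \<i> = 0"
    proof (rule linear_ode_zero[where g = "\<lambda>x. 2 * (D x - 2 * p x) / k" and A = A, OF S _ _ \<tau> z i])
      show "(A has_field_derivative 2 * (D x - 2 * p x) / k * A x) (at x)" if "x \<in> upper_half_plane" for x
        using dA[OF that] by (simp add: mult_ac)
      have "a holomorphic_on upper_half_plane" "b holomorphic_on upper_half_plane" "p holomorphic_on upper_half_plane"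
        using da db dp S(1) by (auto simp: holomorphic_on_open)
      then show "(\<lambda>x. 2 * (D x - 2 * p x) / k) holomorphic_on upper_half_plane"
        unfolding D_def by (intro holomorphic_intros k)
    qed
    then have "f \<i> ^ 2 - 11 * f \<i> - 1 = 0" using f11[OF i] by simp
    moreover obtain x where x: "x > (11 + 5 * sqrt 5) / 2" "f \<i> = of_real x"
      using theta_ratio_at_i f'[OF i] by metis
    ultimately have "complex_of_real (x ^ 2 - 11 * x - 1) = 0" by simp
    then have "x ^ 2 - 11 * x - 1 = 0" by (simp only: of_real_eq_0_iff)
    moreover have "x ^ 2 - 11 * x - 1 = (x - (11 + 5 * sqrt 5) / 2) * (x - (11 - 5 * sqrt 5) / 2)"
      by (simp add: field_simps power2_eq_square)
    moreover have "(11 - 5 * sqrt 5) / 2 < (11 + 5 * sqrt 5) / 2" by simp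
    ultimately show False using x(1) by auto
  qed
  have nz: "a \<tau> - 3 * b \<tau> \<noteq> 0" "3 * a \<tau> + b \<tau> \<noteq> 0" if "\<tau> \<in> upper_half_plane" for \<tau>
    using D0[OF that] by (auto simp: D_def)
  show ?thesis
  proof (intro conjI ballI)
    show "f holomorphic_on upper_half_plane"
      using df S(1) by (auto simp: holomorphic_on_open)
  next
    fix \<tau> assume \<tau>: "\<tau> \<in> upper_half_plane"
    show f0: "f \<tau> \<noteq> 0" using nz[OF \<tau>] f_ab[OF \<tau>] by simp
    show "theta_char 1 (3 / 5) 0 \<tau> \<noteq> 0" using f0 f[OF \<tau>] by auto
    show "f \<tau> ^ 2 - 11 * f \<tau> - 1 \<noteq> 0" using f11[OF \<tau>] A0[OF \<tau>] nz[OF \<tau>] by simp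
    have "deriv f \<tau> = 10 * f \<tau> * A \<tau> / k" using df[OF \<tau>] by (simp add: DERIV_imp_deriv)
    then show "deriv f \<tau> \<noteq> 0" using f0 A0[OF \<tau>] k by simp
    show "let q = exp (2 * of_real pi * \<i> * \<tau>);
           P = (\<lambda>n. (1 + of_real ((1 + sqrt 5) / 2) * q ^ n + q ^ (2 * n)) ^ 5
                   / (1 + of_real ((1 - sqrt 5) / 2) * q ^ n + q ^ (2 * n)) ^ 5)
       in convergent_prod (\<lambda>n. P (Suc n)) \<and>
          f \<tau> = of_real ((11 + 5 * sqrt 5) / 2) * (\<Prod>n. P (Suc n))"
      unfolding Let_def f'[OF \<tau>] using theta_ratio_product[OF im[OF \<tau>]] by blast
    show "schwarzian f \<tau>
        + (f \<tau> ^ 4 - 12 * f \<tau> ^ 3 + 134 * f \<tau> ^ 2 + 12 * f \<tau> + 1)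
            / (2 * f \<tau> ^ 2 * (f \<tau> ^ 2 - 11 * f \<tau> - 1) ^ 2) * (deriv f \<tau>) ^ 2 = 0"
      using schw[OF \<tau> A0[OF \<tau>]] .
  qed
qed

end
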